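(* Let $n,m\ge 1$, $T>0$, $M>0$, and let $f:\mathbb{R}^n\times\mathbb{R}^m\to\mathbb{R}^n$, $r:\mathbb{R}^n\times\mathbb{R}^m\to\mathbb{R}$ and $q:\mathbb{R}^n\to\mathbb{R}$ be bounded and (globally) Lipschitz continuous. Let $\mathbb{U}_1$ be the set of Lipschitz continuous functions $u:[0,T]\to\mathbb{R}^m$ with $|\dot u(t)|\le M$ for a.e. $t$, and define $Q:\mathbb{R}^n\times\mathbb{R}^m\times[0,T]\to\mathbb{R}$ by $$Q(\boldsymbol{x},\boldsymbol{u},t):=\inf_{u\in\mathbb{U}_1}\left\{\int_t^T r(x(s),u(s))\,ds+q(x(T))\ \Big|\ x(t)=\boldsymbol{x},\ u(t)=\boldsymbol{u}\right\},$$ where $x(\cdot)$ solves $\dot x(s)=f(x(s),u(s))$ on $[t,T]$. Then $Q$ is the unique viscosity solution of the Hamilton--Jacobi--Bellman equation $$\partial_t Q+\nabla_{\boldsymbol{x}}Q\cdot f(\boldsymbol{x},\boldsymbol{u})-M|\nabla_{\boldsymbol{u}}Q|+r(\boldsymbol{x},\boldsymbol{u})=0$$ with terminal condition $Q(\boldsymbol{x},\boldsymbol{u},T)=q(\boldsymbol{x})$ (terminal condition included in the definition of viscosity solution). Moreover, $Q$ is bounded and Lipschitz continuous on $\mathbb{R}^n\times\mathbb{R}^m\times[0,T]$.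
   Context: In the definition of $Q$, the infimum is over all $u\in\mathbb{U}_1$ satisfying $u(t)=\boldsymbol{u}$, and for each such $u$, $x(\cdot)$ is the solution of $\dot x=f(x,u)$ with $x(t)=\boldsymbol{x}$. $|\cdot|$ is the Euclidean norm. Viscosity solution: a continuous function $Q:\mathbb{R}^n\times\mathbb{R}^m\times[0,T]\to\mathbb{R}$ is a viscosity solution of the equation if (1) $Q(\boldsymbol{x},\boldsymbol{u},T)=q(\boldsymbol{x})$ for all $\boldsymbol{x}\in\mathbb{R}^n$, $\boldsymbol{u}\in\mathbb{R}^m$; (2) for any $R\in C^1(\mathbb{R}^n\times\mathbb{R}^m\times(0,T))$, if $Q-R$ has a local maximum at a point $(\boldsymbol{x}_0,\boldsymbol{u}_0,t_0)\in\mathbb{R}^n\times\mathbb{R}^m\times(0,T)$, then at that point $\partial_tR+\nabla_{\boldsymbol{x}}R\cdot f(\boldsymbol{x}_0,\boldsymbol{u}_0)-M|\nabla_{\boldsymbol{u}}R|+r(\boldsymbol{x}_0,\boldsymbol{u}_0)\ge 0$; (3) for any $R\in C^1(\mathbb{R}^n\times\mathbb{R}^m\times(0,T))$, if $Q-R$ has a local minimum at a point $(\boldsymbol{x}_0,\boldsymbol{u}_0,t_0)\in\mathbb{R}^n\times\mathbb{R}^m\times(0,T)$, then at that point $\partial_tR+\nabla_{\boldsymbol{x}}R\cdot f(\boldsymbol{x}_0,\boldsymbol{u}_0)-M|\nabla_{\boldsymbol{u}}R|+r(\boldsymbol{x}_0,\boldsymbol{u}_0)\le 0$. Uniqueness is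 among all continuous functions satisfying (1)--(3). *)

theory Defs
  imports "HOL-Analysis.Analysis"
begin

definition admissible_controls :: "real \<Rightarrow> real \<Rightarrow> (real \<Rightarrow> (real ^ 'm)) set" where
  "admissible_controls T M = {u.
     (\<exists>L. L-lipschitz_on {0..T} u) \<and>
     (AE t in lebesgue_on {0..T}.
        \<exists>v. (u has_vector_derivative v) (at t within {0..T}) \<and> norm v \<le> M)}"

(* Only the restriction of x to {t..T} matters; for t = T the differential equation is void. *)
definition solves_state_eq ::
  "((real ^ 'n) \<times> (real ^ 'm) \<Rightarrow> (real ^ 'n)) \<Rightarrow> (real \<Rightarrow> (real ^ 'm)) \<Rightarrow> real \<Rightarrow> real
     \<Rightarrow> (real ^ 'n) \<Rightarrow> (real \<Rightarrow> (real ^ 'n)) \<Rightarrow> bool" where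
  "solves_state_eq f u t T x0 x \<longleftrightarrow>
     x t = x0 \<and>
     (\<forall>s\<in>{t..T}. (x has_vector_derivative f (x s, u s)) (at s within {t..T}))"

(* For f, r, q bounded and Lipschitz every admissible u determines exactly one trajectory x
   on {t..T}, and the set of costs is nonempty and bounded below, so the real-valued Inf is the
   usual infimum. Values at times outside {0..T} are irrelevant. *)
definition value_function ::
  "real \<Rightarrow> real \<Rightarrow> ((real ^ 'n) \<times> (real ^ 'm) \<Rightarrow> (real ^ 'n)) \<Rightarrow> ((real ^ 'n) \<times> (real ^ 'm) \<Rightarrow> real)
     \<Rightarrow> ((real ^ 'n) \<Rightarrow> real) \<Rightarrow> (real ^ 'n) \<times> (real ^ 'm) \<times> real \<Rightarrow> real" where
  "value_function T M f r q = (\<lambda>(x0, u0, t).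
     Inf {integral {t..T} (\<lambda>s. r (x s, u s)) + q (x T) | u x.
            u \<in> admissible_controls T M \<and> u t = u0 \<and> solves_state_eq f u t T x0 x})"

definition C1_on :: "'a::real_inner set \<Rightarrow> ('a \<Rightarrow> real) \<Rightarrow> bool" where
  "C1_on S R \<longleftrightarrow> (\<exists>G. continuous_on S G \<and> (\<forall>z\<in>S. GDERIV R z :> G z))"

definition local_max_at :: "('a::topological_space \<Rightarrow> real) \<Rightarrow> 'a \<Rightarrow> bool" where
  "local_max_at g z0 \<longleftrightarrow> (\<forall>\<^sub>F z in nhds z0. g z \<le> g z0)"

definition local_min_at :: "('a::topological_space \<Rightarrow> real) \<Rightarrow> 'a \<Rightarrow> bool" where
  "local_min_at g z0 \<longleftrightarrow> (\<forall>\<^sub>F z in nhds z0. g z0 \<le> g z)"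

definition hjb_expr ::
  "real \<Rightarrow> ((real ^ 'n) \<times> (real ^ 'm) \<Rightarrow> (real ^ 'n)) \<Rightarrow> ((real ^ 'n) \<times> (real ^ 'm) \<Rightarrow> real)
     \<Rightarrow> (real ^ 'n) \<Rightarrow> (real ^ 'm) \<Rightarrow> (real ^ 'n) \<Rightarrow> (real ^ 'm) \<Rightarrow> real \<Rightarrow> real" where
  "hjb_expr M f r x u p\<^sub>x p\<^sub>u p\<^sub>t = p\<^sub>t + p\<^sub>x \<bullet> f (x, u) - M * norm p\<^sub>u + r (x, u)"

(* Functions on R^n x R^m x [0,T] are total functions of which only the values on
   UNIV x UNIV x {0..T} are used. The inner product on the product space is the sum of the
   componentwise ones, so the gradient of a test function R is the triple (p_x, p_u, p_t) of its
   partial gradients; it is unique, so quantifying over it universally just names it. *)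
definition hjb_viscosity_solution ::
  "real \<Rightarrow> real \<Rightarrow> ((real ^ 'n) \<times> (real ^ 'm) \<Rightarrow> (real ^ 'n)) \<Rightarrow> ((real ^ 'n) \<times> (real ^ 'm) \<Rightarrow> real)
     \<Rightarrow> ((real ^ 'n) \<Rightarrow> real) \<Rightarrow> ((real ^ 'n) \<times> (real ^ 'm) \<times> real \<Rightarrow> real) \<Rightarrow> bool" where
  "hjb_viscosity_solution T M f r q Q \<longleftrightarrow>
     continuous_on (UNIV \<times> UNIV \<times> {0..T}) Q \<and>
     (\<forall>x u. Q (x, u, T) = q x) \<and>
     (\<forall>R. C1_on (UNIV \<times> UNIV \<times> {0<..<T}) R \<longrightarrow>
        (\<forall>x0 u0. \<forall>t0\<in>{0<..<T}.
           local_max_at (\<lambda>z. Q z - R z) (x0, u0, t0) \<longrightarrow>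
           (\<forall>p\<^sub>x p\<^sub>u p\<^sub>t. GDERIV R (x0, u0, t0) :> (p\<^sub>x, p\<^sub>u, p\<^sub>t) \<longrightarrow>
              hjb_expr M f r x0 u0 p\<^sub>x p\<^sub>u p\<^sub>t \<ge> 0))) \<and>
     (\<forall>R. C1_on (UNIV \<times> UNIV \<times> {0<..<T}) R \<longrightarrow>
        (\<forall>x0 u0. \<forall>t0\<in>{0<..<T}.
           local_min_at (\<lambda>z. Q z - R z) (x0, u0, t0) \<longrightarrow>
           (\<forall>p\<^sub>x p\<^sub>u p\<^sub>t. GDERIV R (x0, u0, t0) :> (p\<^sub>x, p\<^sub>u, p\<^sub>t) \<longrightarrow>
              hjb_expr M f r x0 u0 p\<^sub>x p\<^sub>u p\<^sub>t \<le> 0)))"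

end

theory Submission
  imports Defs
begin

text \<open>
  Admissible controls turn out to be \<open>M\<close>-Lipschitz, and they can be translated and concatenated;
  with Picard's theorem and Gronwall's inequality this gives the dynamic programming principle
  and the Lipschitz bounds for the value function. Following the affine controls
  \<open>u + (s - t) v\<close>, \<open>\<bar>v\<bar> \<le> M\<close>, for a short time yields the subsolution inequality; a control that is
  optimal up to \<open>\<epsilon>h\<close> on \<open>[t, t + h]\<close> yields the supersolution inequality. Uniqueness is proved by doubling of
  variables. Since \<open>f\<close> and the control speed are bounded, information propagates with speed at most
  \<open>\<bar>f\<bar> + M\<close>, so the comparison can be localized to a compact box and no growth condition on the
  competing solution is needed.
\<close>

text \<open>The coordinate u is itself a state: it moves with a velocity v chosen freely in the ball
  of radius M, and \<open>- M * norm pu\<close> is the minimum of pu . v over that ball. As f and v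
  are bounded, a time step h causes displacements of order h, uniformly over all controls. The
  supersolution proof lives on this: the control is picked after h, its velocity need not converge
  as h shrinks, and only the displacement bound \<open>norm \<eta> \<le> M * h\<close> enters.

  Admissibility offers some Lipschitz constant and an almost everywhere bound on the derivative;
  replacing that constant by M takes a mean value inequality with a negligible exceptional set.

  In the comparison the delicate error is k * D^2, with D the distance of the two maximizing points
  and k large. It becomes small by testing the maximum against a pair on the diagonal. The
  exponential penalty costs nothing, because its time derivative absorbs B and M times the norms of
  its two spatial gradients.\<close>

section \<open>Lipschitz bounds from almost everywhere derivatives and admissible controls\<close>

text \<open>If \<open>h a < h b\<close>, some level \<open>y\<close> between them is missed by the negligible set \<open>h ` E\<close>;
  at the last time where \<open>h \<le> y\<close> the derivative cannot be negative.\<close>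

lemma lipschitz_ae_neg_deriv_le:
  fixes h :: "real \<Rightarrow> real"
  assumes lip: "L-lipschitz_on {a..b} h" and "a \<le> b" and "negligible E"
    and neg: "\<And>s. s \<in> {a..b} - E \<Longrightarrow> \<exists>d<0. (h has_real_derivative d) (at s within {a..b})"
  shows "h b \<le> h a"
proof (rule ccontr)
  assume "\<not> h b \<le> h a"
  have "negligible (h ` (E \<inter> {a..b}))"
  proof (rule negligible_locally_Lipschitz_image)
    show "negligible (E \<inter> {a..b})" using \<open>negligible E\<close> negligible_subset by blast
    show "\<exists>T B. open T \<and> x \<in> T \<and> (\<forall>y\<in>E \<inter> {a..b} \<inter> T. norm (h y - h x) \<le> B * norm (y - x))"
      if "x \<in> E \<inter> {a..b}" for x
      using that lipschitz_on_normD[OF lip] by (intro exI[of _ UNIV] exI[of _ L]) auto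
  qed simp
  moreover have "\<not> negligible {h a<..<h b}"
    using \<open>\<not> h b \<le> h a\<close> open_not_negligible[of "{h a<..<h b}"] by auto
  ultimately obtain y where y: "h a < y" "y < h b" "y \<notin> h ` (E \<inter> {a..b})"
    by (meson greaterThanLessThan_iff negligible_subset subsetI)
  have cont: "continuous_on {a..b} h" using lip by (rule lipschitz_on_continuous_on)
  define S where "S = {s \<in> {a..b}. h s \<le> y}"
  have "closed S" unfolding S_def
    using continuous_closed_preimage[OF cont closed_atLeastAtMost closed_atMost[of y]]
    by (simp add: vimage_def Int_def)
  moreover have "a \<in> S" using y \<open>a \<le> b\<close> by (auto simp: S_def)
  moreover have bdd: "bdd_above S" by (auto simp: S_def)
  ultimately have sS: "Sup S \<in> S" by (intro closed_contains_Sup) auto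
  define s where "s = Sup S"
  have s: "a \<le> s" "s \<le> b" "h s \<le> y" using sS by (auto simp: S_def s_def)
  have above: "t \<le> s" if "t \<in> {a..b}" "h t \<le> y" for t
    unfolding s_def using that bdd by (intro cSup_upper) (auto simp: S_def)
  obtain c where c: "s \<le> c" "c \<le> b" "h c = y"
    using IVT'[of h s y b] s y continuous_on_subset[OF cont, of "{s..b}"] by auto
  have "c = s" using above[of c] c s by auto
  then have "h s = y" "s \<noteq> b" "s \<in> {a..b} - E" using c y s by auto
  with neg obtain d where "d < 0" "(h has_real_derivative d) (at s within {a..b})" by blast
  then obtain e where e: "e > 0" "\<And>t. t > 0 \<Longrightarrow> s + t \<in> {a..b} \<Longrightarrow> t < e \<Longrightarrow> h (s + t) < h s"
    using has_real_derivative_neg_dec_right by blast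
  define t where "t = min (e/2) (b - s)"
  have "0 < t" "t < e" "s + t \<in> {a..b}" using e s \<open>s \<noteq> b\<close> by (auto simp: t_def)
  then show False using e(2)[of t] above[of "s + t"] \<open>h s = y\<close> by auto
qed

text \<open>Projecting u onto w = u b - u a gives a scalar problem. Subtracting a line of slope (M +
  e) * norm w makes the available derivatives at most - e * norm w, hence strictly negative as the
  preceding lemma requires; e is sent to 0 at the end.\<close>

lemma lipschitz_ae_bounded_deriv_norm_le:
  fixes u :: "real \<Rightarrow> 'a::real_inner"
  assumes lip: "L-lipschitz_on {a..b} u" and "a \<le> b" and "negligible E"
    and der: "\<And>s. s \<in> {a..b} - E \<Longrightarrow>
      \<exists>v. (u has_vector_derivative v) (at s within {a..b}) \<and> norm v \<le> M"
  shows "norm (u b - u a) \<le> M * (b - a)"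
proof (cases "u b = u a")
  case True
  \<comment> \<open>The sign of M is not given. A negligible set cannot contain an open interval, so
    a derivative of norm at most M exists somewhere.\<close>
  have "M \<ge> 0" if "a < b"
  proof -
    have "\<not> {a<..<b} \<subseteq> E"
      using that open_not_negligible[of "{a<..<b}"] \<open>negligible E\<close>
        negligible_subset[of E "{a<..<b}"] by auto
    then obtain s where "s \<in> {a<..<b}" "s \<notin> E" by blast
    then have "s \<in> {a..b} - E" by simp
    from der[OF this] show ?thesis using norm_ge_zero order_trans by blast
  qed
  with True \<open>a \<le> b\<close> show ?thesis by (cases "a = b") auto
next
  case False
  define w where "w = u b - u a"
  have "w \<noteq> 0" using False by (simp add: w_def)
  have "norm w \<le> M * (b - a) + e * (b - a)" if "e > 0" for e
  proof -
    define h where "h = (\<lambda>\<tau>. u \<tau> \<bullet> w - (M + e) * norm w * \<tau>)"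
    have "(L * norm w + \<bar>(M + e) * norm w\<bar>)-lipschitz_on {a..b} h"
    proof (rule lipschitz_onI)
      fix x y assume xy: "x \<in> {a..b}" "y \<in> {a..b}"
      have "h x - h y = (u x - u y) \<bullet> w - ((M + e) * norm w) * (x - y)"
        by (simp add: h_def algebra_simps)
      also have "\<bar>\<dots>\<bar> \<le> norm (u x - u y) * norm w + \<bar>(M + e) * norm w\<bar> * \<bar>x - y\<bar>"
        using Cauchy_Schwarz_ineq2[of "u x - u y" w] abs_triangle_ineq4[of "(u x - u y) \<bullet> w" "(M + e) * norm w * (x - y)"]
        by (simp add: abs_mult)
      also have "norm (u x - u y) \<le> L * \<bar>x - y\<bar>"
        using lipschitz_on_normD[OF lip xy] by simp
      finally show "dist (h x) (h y) \<le> (L * norm w + \<bar>(M + e) * norm w\<bar>) * dist x y"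
        by (simp add: dist_real_def algebra_simps mult_right_mono)
    qed (use lipschitz_on_nonneg[OF lip] in auto)
    moreover have "\<exists>d<0. (h has_real_derivative d) (at s within {a..b})" if s: "s \<in> {a..b} - E" for s
    proof -
      obtain v where v: "(u has_vector_derivative v) (at s within {a..b})" "norm v \<le> M"
        using der[OF s] by blast
      have "(h has_real_derivative (v \<bullet> w - (M + e) * norm w)) (at s within {a..b})"
        unfolding h_def has_real_derivative_iff_has_vector_derivative
        using v(1) by (auto intro!: derivative_eq_intros simp: has_vector_derivative_def algebra_simps)
      moreover have "v \<bullet> w \<le> M * norm w"
        by (meson mult_right_mono norm_cauchy_schwarz norm_ge_zero order_trans v(2))
      moreover have "e * norm w > 0" using \<open>e > 0\<close> \<open>w \<noteq> 0\<close> by simp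
      ultimately show ?thesis by (intro exI[of _ "v \<bullet> w - (M + e) * norm w"]) (auto simp: algebra_simps)
    qed
    ultimately have "h b \<le> h a" by (rule lipschitz_ae_neg_deriv_le[OF _ \<open>a \<le> b\<close> \<open>negligible E\<close>])
    then have "w \<bullet> w \<le> (M + e) * (b - a) * norm w"
      by (simp add: h_def w_def algebra_simps)
    then have "norm w * norm w \<le> ((M + e) * (b - a)) * norm w"
      by (simp add: norm_eq_sqrt_inner)
    then have "norm w \<le> (M + e) * (b - a)"
      using \<open>w \<noteq> 0\<close> mult_right_le_imp_le[of "norm w" "norm w" "(M + e) * (b - a)"] by simp
    then show ?thesis by (simp add: algebra_simps)
  qed
  note * = this
  have "norm w \<le> M * (b - a)"
  proof (rule field_le_epsilon)
    fix e :: real assume "e > 0"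
    show "norm w \<le> M * (b - a) + e"
    proof (cases "a < b")
      case True
      have "e / (b - a) > 0" using True \<open>e > 0\<close> by simp
      from *[OF this] show ?thesis
        using True by simp
    next
      case False then show ?thesis using \<open>a \<le> b\<close> \<open>e > 0\<close> by (simp add: w_def)
    qed
  qed
  then show ?thesis by (simp add: w_def)
qed

section \<open>Admissible controls: speed bound, affine controls, translation, concatenation\<close>

lemma admissible_controls_iff:
  "u \<in> admissible_controls T M \<longleftrightarrow>
     (\<exists>L. L-lipschitz_on {0..T} u) \<and>
     (\<exists>E. negligible E \<and> (\<forall>t\<in>{0..T} - E.
        \<exists>v. (u has_vector_derivative v) (at t within {0..T}) \<and> norm v \<le> M))"
proof -
  have "(AE t in lebesgue_on {0..T}. P t) \<longleftrightarrow> (\<exists>E. negligible E \<and> (\<forall>t\<in>{0..T} - E. P t))" for P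
  proof -
    have "(AE t in lebesgue_on {0..T}. P t) \<longleftrightarrow> (AE t in lebesgue. t \<in> {0..T} \<longrightarrow> P t)"
      by (rule AE_restrict_space_iff) simp
    also have "\<dots> \<longleftrightarrow> (\<exists>E. negligible E \<and> (\<forall>t\<in>{0..T} - E. P t))"
    proof
      assume "AE t in lebesgue. t \<in> {0..T} \<longrightarrow> P t"
      then obtain N where "N \<in> null_sets lebesgue" "{t. \<not> (t \<in> {0..T} \<longrightarrow> P t)} \<subseteq> N"
        unfolding eventually_ae_filter by auto
      then show "\<exists>E. negligible E \<and> (\<forall>t\<in>{0..T} - E. P t)"
        unfolding negligible_iff_null_sets by blast
    next
      assume "\<exists>E. negligible E \<and> (\<forall>t\<in>{0..T} - E. P t)"
      then obtain N where "N \<in> null_sets lebesgue" "\<forall>t\<in>{0..T} - N. P t"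
        unfolding negligible_iff_null_sets by blast
      then show "AE t in lebesgue. t \<in> {0..T} \<longrightarrow> P t"
        by (intro AE_I'[of N]) auto
    qed
    finally show ?thesis .
  qed
  then show ?thesis by (simp add: admissible_controls_def)
qed

lemma admissible_norm_diff_le:
  assumes "u \<in> admissible_controls T M" "s \<in> {0..T}" "t \<in> {0..T}" "s \<le> t"
  shows "norm (u t - u s) \<le> M * (t - s)"
proof -
  obtain L E where L: "L-lipschitz_on {0..T} u" and E: "negligible E"
    "\<And>t. t\<in>{0..T} - E \<Longrightarrow> \<exists>v. (u has_vector_derivative v) (at t within {0..T}) \<and> norm v \<le> M"
    using assms(1) unfolding admissible_controls_iff by auto
  show ?thesis
  proof (rule lipschitz_ae_bounded_deriv_norm_le[OF _ \<open>s \<le> t\<close> E(1)])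
    show "L-lipschitz_on {s..t} u" using assms by (intro lipschitz_on_subset[OF L]) auto
    show "\<exists>v. (u has_vector_derivative v) (at \<tau> within {s..t}) \<and> norm v \<le> M"
      if "\<tau> \<in> {s..t} - E" for \<tau>
    proof -
      have "{s..t} \<subseteq> {0..T}" "\<tau> \<in> {0..T} - E" using that assms by auto
      with E(2)[of \<tau>] show ?thesis using has_vector_derivative_within_subset by blast
    qed
  qed
qed

lemma admissible_continuous_on:
  "u \<in> admissible_controls T M \<Longrightarrow> continuous_on {0..T} u"
  unfolding admissible_controls_iff using lipschitz_on_continuous_on by blast

lemma admissible_affine:
  assumes "norm v \<le> M"
  shows "(\<lambda>s. u0 + (s - t) *\<^sub>R v) \<in> admissible_controls T M"
proof -
  have "(norm v)-lipschitz_on {0..T} (\<lambda>s. u0 + (s - t) *\<^sub>R v)"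
    by (rule lipschitz_onI) (auto simp: dist_norm simp flip: scaleR_diff_left)
  moreover have "((\<lambda>s. u0 + (s - t) *\<^sub>R v) has_vector_derivative v) (at s within {0..T})" for s
    by (auto intro!: derivative_eq_intros)
  ultimately show ?thesis
    unfolding admissible_controls_iff using assms by (auto intro!: exI[of _ "{}"])
qed

lemma admissible_add_const:
  assumes "u \<in> admissible_controls T M"
  shows "(\<lambda>s. u s + c) \<in> admissible_controls T M"
proof -
  obtain L E where L: "L-lipschitz_on {0..T} u" and E: "negligible E"
    "\<And>t. t\<in>{0..T} - E \<Longrightarrow> \<exists>v. (u has_vector_derivative v) (at t within {0..T}) \<and> norm v \<le> M"
    using assms unfolding admissible_controls_iff by auto
  have "L-lipschitz_on {0..T} (\<lambda>s. u s + c)"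
    using L by (auto simp: lipschitz_on_def)
  moreover have "\<exists>v. ((\<lambda>s. u s + c) has_vector_derivative v) (at t within {0..T}) \<and> norm v \<le> M"
    if t: "t \<in> {0..T} - E" for t
    using E(2)[OF t] by (simp add: has_vector_derivative_add_const)
  ultimately show ?thesis
    unfolding admissible_controls_iff using E(1) by blast
qed

lemma admissible_concat:
  assumes u: "u \<in> admissible_controls T M" and w: "w \<in> admissible_controls T M"
    and eq: "u c = w c" and c: "c \<in> {0..T}"
  shows "(\<lambda>s. if s \<le> c then u s else w s) \<in> admissible_controls T M" (is "?z \<in> _")
proof -
  obtain L1 E1 where L1: "L1-lipschitz_on {0..T} u" and E1: "negligible E1"
    "\<And>t. t\<in>{0..T} - E1 \<Longrightarrow> \<exists>v. (u has_vector_derivative v) (at t within {0..T}) \<and> norm v \<le> M"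
    using u unfolding admissible_controls_iff by auto
  obtain L2 E2 where L2: "L2-lipschitz_on {0..T} w" and E2: "negligible E2"
    "\<And>t. t\<in>{0..T} - E2 \<Longrightarrow> \<exists>v. (w has_vector_derivative v) (at t within {0..T}) \<and> norm v \<le> M"
    using w unfolding admissible_controls_iff by auto
  have "(max L1 L2)-lipschitz_on {0..T} ?z"
    using c by (intro lipschitz_on_concat_max lipschitz_on_subset[OF L1] lipschitz_on_subset[OF L2] eq) auto
  \<comment> \<open>The one-sided derivatives may differ at the junction, so c joins the exceptional
    set.\<close>
  moreover have "negligible (insert c (E1 \<union> E2))" using E1(1) E2(1) by simp
  moreover have "\<exists>v. (?z has_vector_derivative v) (at t within {0..T}) \<and> norm v \<le> M"
    if t: "t \<in> {0..T} - insert c (E1 \<union> E2)" for t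
  proof (cases "t < c")
    case True
    obtain v where v: "(u has_vector_derivative v) (at t within {0..T})" "norm v \<le> M"
      using E1(2)[of t] t by blast
    have "(?z has_vector_derivative v) (at t within {0..T})"
      by (rule has_vector_derivative_transform_within[OF v(1), of "c - t"])
         (use t True in \<open>auto simp: dist_real_def\<close>)
    with v show ?thesis by blast
  next
    case False
    obtain v where v: "(w has_vector_derivative v) (at t within {0..T})" "norm v \<le> M"
      using E2(2)[of t] t by blast
    have "(?z has_vector_derivative v) (at t within {0..T})"
      by (rule has_vector_derivative_transform_within[OF v(1), of "t - c"])
         (use t False in \<open>auto simp: dist_real_def\<close>)
    with v show ?thesis by blast
  qed
  ultimately show ?thesis
    unfolding admissible_controls_iff by blast
qed

section \<open>Ordinary differential equations\<close>

lemma vector_derivative_norm_diff_le: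
  fixes x :: "real \<Rightarrow> 'a::real_normed_vector"
  assumes "a \<le> b"
    and der: "\<And>s. s \<in> {a..b} \<Longrightarrow> (x has_vector_derivative x' s) (at s within {a..b})"
    and bound: "\<And>s. s \<in> {a..b} \<Longrightarrow> norm (x' s) \<le> C"
  shows "norm (x b - x a) \<le> C * (b - a)"
proof -
  have "norm (x b - x a) \<le> C * norm (b - a)"
  proof (rule differentiable_bound[of "{a..b}"])
    show "(x has_derivative (\<lambda>h. h *\<^sub>R x' s)) (at s within {a..b})" if "s \<in> {a..b}" for s
      using der[OF that] by (simp only: has_vector_derivative_def)
    show "onorm (\<lambda>h. h *\<^sub>R x' s) \<le> C" if "s \<in> {a..b}" for s
      using bound[OF that] by (simp add: onorm_scaleR_left onorm_id)
  qed (use \<open>a \<le> b\<close> in auto)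
  then show ?thesis using \<open>a \<le> b\<close> by simp
qed

lemma has_integral_exp_scaled:
  fixes k :: real
  assumes "k \<noteq> 0" "a \<le> b"
  shows "((\<lambda>\<tau>. exp (k * (\<tau> - a))) has_integral ((exp (k * (b - a)) - 1) / k)) {a..b}"
proof -
  have "((\<lambda>\<tau>. exp (k * (\<tau> - a)) / k) has_vector_derivative exp (k * (\<tau> - a))) (at \<tau> within {a..b})" for \<tau>
    using \<open>k \<noteq> 0\<close> unfolding has_real_derivative_iff_has_vector_derivative[symmetric]
    by (auto intro!: derivative_eq_intros)
  from fundamental_theorem_of_calculus[OF \<open>a \<le> b\<close> this]
  show ?thesis by (simp add: diff_divide_distrib)
qed

text \<open>Picard iteration is a contraction in one step, for the sup norm of
  \<^term>\<open>exp (- k * (s - a)) *\<^sub>R x s\<close> with \<^term>\<open>k\<close> large.\<close>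

lemma lipschitz_ode_exists:
  fixes g :: "real \<Rightarrow> 'a::euclidean_space \<Rightarrow> 'a"
  assumes cont: "\<And>y. continuous_on {a..b} y \<Longrightarrow> continuous_on {a..b} (\<lambda>s. g s (y s))"
    and lip: "\<And>s y z. s \<in> {a..b} \<Longrightarrow> norm (g s y - g s z) \<le> L * norm (y - z)"
    and "L \<ge> 0" "a \<le> b"
  obtains x where "x a = x0" "\<And>s. s \<in> {a..b} \<Longrightarrow> (x has_vector_derivative g s (x s)) (at s within {a..b})"
proof -
  \<comment> \<open>In the weighted norm the contraction factor is L / k; this k is positive even
    for L = 0 and keeps the factor at most 1/2.\<close>
  define k where "k = 2 * L + 1"
  have k: "k > 0" "L / k \<le> 1 / 2" using \<open>L \<ge> 0\<close> by (auto simp: k_def field_simps)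
  \<comment> \<open>The fixed point is sought among bounded continuous functions on the whole line;
    the clamp \<open>cl\<close> extends functions on {a..b} by their end values.\<close>
  define cl where "cl = (\<lambda>s. max a (min b s))"
  have cl: "cl s \<in> {a..b}" "s \<in> {a..b} \<Longrightarrow> cl s = s" for s using \<open>a \<le> b\<close> by (auto simp: cl_def)
  have cl_cont: "continuous_on UNIV cl" unfolding cl_def by (intro continuous_intros)
  \<comment> \<open>Here y is the weighted unknown; the exponential factor turns it back into the
    candidate trajectory.\<close>
  define G where "G = (\<lambda>y \<tau>. g \<tau> (exp (k * (\<tau> - a)) *\<^sub>R y \<tau>))"
  define P where "P = (\<lambda>y s. exp (- k * (s - a)) *\<^sub>R (x0 + integral {a..s} (G y)))"
  have G_cont: "continuous_on {a..b} (G y)" if "continuous_on {a..b} y" for y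
    unfolding G_def by (intro cont continuous_intros that)
  have G_int: "G y integrable_on {a..s}" if "continuous_on {a..b} y" "s \<in> {a..b}" for y s
    using continuous_on_subset[OF G_cont[OF that(1)], of "{a..s}"] that(2)
    by (intro integrable_continuous_real) auto
  have P_cont: "continuous_on {a..b} (P y)" if "continuous_on {a..b} y" for y
    unfolding P_def
    by (intro continuous_intros indefinite_integral_continuous_1 G_int that) (use \<open>a \<le> b\<close> in auto)
  have P_bcontfun: "(\<lambda>s. P y (cl s)) \<in> bcontfun" if "continuous_on {a..b} y" for y
  proof -
    have "continuous_on UNIV (\<lambda>s. P y (cl s))"
      using cl by (intro continuous_on_compose2[OF P_cont[OF that] cl_cont]) auto
    moreover have "bounded (range (\<lambda>s. P y (cl s)))"
      using compact_imp_bounded[OF compact_continuous_image[OF P_cont[OF that] compact_Icc]] cl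
      by (elim bounded_subset) auto
    ultimately show ?thesis by (simp add: bcontfun_def)
  qed
  define \<Phi> :: "(real \<Rightarrow>\<^sub>C 'a) \<Rightarrow> (real \<Rightarrow>\<^sub>C 'a)" where "\<Phi> = (\<lambda>y. Bcontfun (\<lambda>s. P y (cl s)))"
  have \<Phi>: "apply_bcontfun (\<Phi> y) s = P y (cl s)" for y s
    unfolding \<Phi>_def by (subst Bcontfun_inverse[OF P_bcontfun]) auto
  have "dist (\<Phi> y) (\<Phi> z) \<le> 1 / 2 * dist y z" for y z
  proof (rule dist_bound)
    fix s0 define s where "s = cl s0"
    have s: "s \<in> {a..b}" "a \<le> s" using cl[of s0] by (auto simp: s_def)
    define D where "D = dist y z"
    have int: "G y integrable_on {a..s}" "G z integrable_on {a..s}" using s by (auto intro!: G_int)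
    have E: "((\<lambda>\<tau>. (L * D) * exp (k * (\<tau> - a))) has_integral (L * D) * ((exp (k * (s - a)) - 1) / k)) {a..s}"
      using has_integral_exp_scaled[of k a s] k s by (intro has_integral_mult_right) auto
    have "norm (integral {a..s} (\<lambda>\<tau>. G y \<tau> - G z \<tau>)) \<le> integral {a..s} (\<lambda>\<tau>. (L * D) * exp (k * (\<tau> - a)))"
    proof (rule integral_norm_bound_integral)
      show "(\<lambda>\<tau>. G y \<tau> - G z \<tau>) integrable_on {a..s}" using int by (rule integrable_diff)
      show "(\<lambda>\<tau>. (L * D) * exp (k * (\<tau> - a))) integrable_on {a..s}" using E by blast
      fix \<tau> assume "\<tau> \<in> {a..s}"
      then have "norm (G y \<tau> - G z \<tau>) \<le> L * norm (exp (k * (\<tau> - a)) *\<^sub>R (apply_bcontfun y \<tau> - apply_bcontfun z \<tau>))"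
        unfolding G_def scaleR_diff_right using s by (intro lip) auto
      also have "\<dots> = exp (k * (\<tau> - a)) * (L * dist (apply_bcontfun y \<tau>) (apply_bcontfun z \<tau>))"
        by (simp add: dist_norm)
      also have "\<dots> \<le> exp (k * (\<tau> - a)) * (L * D)"
        unfolding D_def using \<open>L \<ge> 0\<close> by (intro mult_left_mono dist_bounded) auto
      finally show "norm (G y \<tau> - G z \<tau>) \<le> (L * D) * exp (k * (\<tau> - a))" by (simp add: mult.commute)
    qed
    also have "\<dots> = (L * D) * ((exp (k * (s - a)) - 1) / k)" using E by (rule integral_unique)
    also have "\<dots> = L / k * D * (exp (k * (s - a)) - 1)" by simp
    also have "\<dots> \<le> 1 / 2 * D * (exp (k * (s - a)) - 1)"
      using k s by (intro mult_right_mono) (auto simp: D_def)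
    also have "\<dots> \<le> 1 / 2 * D * exp (k * (s - a))" by (simp add: D_def algebra_simps)
    finally have *: "norm (integral {a..s} (\<lambda>\<tau>. G y \<tau> - G z \<tau>)) \<le> 1 / 2 * D * exp (k * (s - a))" .
    have "dist (apply_bcontfun (\<Phi> y) s0) (apply_bcontfun (\<Phi> z) s0)
        = exp (- k * (s - a)) * norm (integral {a..s} (\<lambda>\<tau>. G y \<tau> - G z \<tau>))"
      unfolding \<Phi> s_def[symmetric] P_def dist_norm integral_diff[OF int] scaleR_diff_right[symmetric] by simp
    also have "\<dots> \<le> exp (- k * (s - a)) * (1 / 2 * D * exp (k * (s - a)))"
      using * by (rule mult_left_mono) simp
    also have "\<dots> = 1 / 2 * D" by (simp add: exp_minus)
    finally show "dist (apply_bcontfun (\<Phi> y) s0) (apply_bcontfun (\<Phi> z) s0) \<le> 1 / 2 * dist y z"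
      by (simp add: D_def)
  qed
  then have "\<exists>!y. \<Phi> y = y" by (intro banach_fix_type[of "1/2"]) auto
  then obtain y where y: "\<Phi> y = y" by blast
  define x where "x = (\<lambda>s. exp (k * (s - a)) *\<^sub>R apply_bcontfun y s)"
  have y_eq: "apply_bcontfun y s = P y s" if "s \<in> {a..b}" for s
    using \<Phi>[of y s] y cl(2)[OF that] by simp
  have x_eq: "x s = x0 + integral {a..s} (\<lambda>\<tau>. g \<tau> (x \<tau>))" if "s \<in> {a..b}" for s
    unfolding x_def y_eq[OF that] P_def G_def by (simp add: exp_minus)
  have "continuous_on {a..b} (\<lambda>\<tau>. g \<tau> (x \<tau>))"
    unfolding x_def by (intro cont continuous_intros) auto
  from integral_has_vector_derivative[OF this]
  have "((\<lambda>s. x0 + integral {a..s} (\<lambda>\<tau>. g \<tau> (x \<tau>))) has_vector_derivative g s (x s)) (at s within {a..b})"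
    if "s \<in> {a..b}" for s
    using that by (auto intro!: derivative_eq_intros)
  then have "(x has_vector_derivative g s (x s)) (at s within {a..b})" if "s \<in> {a..b}" for s
    using that x_eq by (auto intro: has_vector_derivative_transform)
  moreover have "x a = x0" using x_eq[of a] \<open>a \<le> b\<close> by simp
  ultimately show ?thesis by (intro that)
qed

text \<open>The squared distance is differentiable where the distance may not be, and adding d^2
  absorbs the forcing: with n = norm (x s - y s), 2 n (n + d) \<le> 3 (n^2 + d^2), so
  \<open>e\<close> grows at rate at most 3 L. In the application d is the constant gap between two
  translated controls.\<close>

lemma ode_gronwall:
  fixes x y :: "real \<Rightarrow> 'a::real_inner"
  assumes x: "\<And>s. s \<in> {a..b} \<Longrightarrow> (x has_vector_derivative x' s) (at s within {a..b})"
    and y: "\<And>s. s \<in> {a..b} \<Longrightarrow> (y has_vector_derivative y' s) (at s within {a..b})"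
    and le: "\<And>s. s \<in> {a..b} \<Longrightarrow> norm (x' s - y' s) \<le> L * (norm (x s - y s) + d)"
    and "L \<ge> 0" "d \<ge> 0" and c: "c \<in> {a..b}"
  shows "norm (x c - y c) \<le> exp (3 * L * (b - a)) * (norm (x a - y a) + d)"
proof -
  define e where "e = (\<lambda>s. (x s - y s) \<bullet> (x s - y s) + d\<^sup>2)"
  define h where "h = (\<lambda>s. e s * exp (- 3 * L * (s - a)))"
  define e' where "e' = (\<lambda>s. 2 * ((x s - y s) \<bullet> (x' s - y' s)))"
  have e': "e' s \<le> 3 * L * e s" if "s \<in> {a..b}" for s
  proof -
    define n where "n = norm (x s - y s)"
    have "(x s - y s) \<bullet> (x' s - y' s) \<le> n * norm (x' s - y' s)"
      unfolding n_def by (rule norm_cauchy_schwarz)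
    also have "\<dots> \<le> n * (L * (n + d))" unfolding n_def by (intro mult_left_mono le that) auto
    finally have "e' s \<le> L * (2 * n\<^sup>2 + 2 * n * d)" by (simp add: e'_def power2_eq_square algebra_simps)
    also have "2 * n * d \<le> n\<^sup>2 + d\<^sup>2" by (rule sum_squares_bound)
    then have "L * (2 * n\<^sup>2 + 2 * n * d) \<le> L * (3 * (n\<^sup>2 + d\<^sup>2))" using \<open>L \<ge> 0\<close>
      by (intro mult_left_mono) (auto intro: order_trans[OF _ add_mono])
    also have "n\<^sup>2 + d\<^sup>2 = e s" by (simp add: e_def n_def power2_norm_eq_inner)
    finally show ?thesis by simp
  qed
  have "(h has_real_derivative (e' s * exp (- 3 * L * (s - a)) + e s * (- 3 * L * exp (- 3 * L * (s - a)))))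
      (at s within {a..b})" if "s \<in> {a..b}" for s
    unfolding h_def e_def e'_def has_real_derivative_iff_has_vector_derivative
    using x[OF that] y[OF that]
    by (auto intro!: derivative_eq_intros simp: has_vector_derivative_def fun_eq_iff inner_commute algebra_simps)
  note * = this
  have h': "(h has_real_derivative ((e' s - 3 * L * e s) * exp (- 3 * L * (s - a)))) (at s within {a..b})"
    if "s \<in> {a..b}" for s
    by (rule DERIV_cong[OF *[OF that]]) (simp add: left_diff_distrib)
  have h'_le: "(e' s - 3 * L * e s) * exp (- 3 * L * (s - a)) \<le> 0" if "s \<in> {a..b}" for s
    using e'[OF that] by (intro mult_nonpos_nonneg) auto
  have "h c \<le> h a"
  proof (rule DERIV_nonpos_imp_decreasing_open[of a c h])
    show "a \<le> c" using c by simp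
    have "continuous_on {a..b} h" by (rule DERIV_continuous_on[OF h'])
    then show "continuous_on {a..c} h" using c by (elim continuous_on_subset) auto
    fix s assume "a < s" "s < c"
    then have s: "s \<in> {a..b}" "at s within {a..b} = at s" using c by (auto simp: at_within_Icc_at)
    show "\<exists>l. DERIV h s :> l \<and> l \<le> 0"
      using h'[OF s(1)] h'_le[OF s(1)] unfolding s(2) by (intro exI conjI)
  qed
  then have "e c * exp (- 3 * L * (c - a)) \<le> e a" by (simp add: h_def)
  from mult_right_mono[OF this, of "exp (3 * L * (c - a))"]
  have "e c \<le> e a * exp (3 * L * (c - a))"
    by (simp add: mult.assoc flip: exp_add)
  moreover have "e a \<le> (norm (x a - y a) + d)\<^sup>2"
    using \<open>d \<ge> 0\<close> by (simp add: e_def power2_norm_eq_inner[symmetric] power2_sum)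
  \<comment> \<open>Squaring the factor is wasteful but makes the right-hand side a perfect square,
    so that the root can be taken.\<close>
  moreover have "exp (3 * L * (c - a)) \<le> (exp (3 * L * (b - a)))\<^sup>2"
  proof -
    have "3 * L * (c - a) \<le> 3 * L * (b - a)" "0 \<le> 3 * L * (b - a)"
      using c \<open>L \<ge> 0\<close> by (auto intro!: mult_left_mono mult_nonneg_nonneg)
    then have "3 * L * (c - a) \<le> 3 * L * (b - a) + 3 * L * (b - a)" by linarith
    then show ?thesis by (simp add: power2_eq_square flip: exp_add)
  qed
  ultimately have "e c \<le> (norm (x a - y a) + d)\<^sup>2 * (exp (3 * L * (b - a)))\<^sup>2"
    by (smt (verit) exp_ge_zero mult_mono zero_le_power2)
  moreover have "(norm (x c - y c))\<^sup>2 \<le> e c" by (simp add: e_def power2_norm_eq_inner)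
  ultimately have "(norm (x c - y c))\<^sup>2 \<le> (exp (3 * L * (b - a)) * (norm (x a - y a) + d))\<^sup>2"
    by (simp add: power_mult_distrib mult.commute)
  then show ?thesis using \<open>d \<ge> 0\<close> by (elim power2_le_imp_le) auto
qed

section \<open>The value function\<close>

lemma norm_triple_le: "norm (x, u, t) \<le> norm x + norm u + norm t"
  using norm_Pair_le[of x "(u, t)"] norm_Pair_le[of u t] by linarith

text \<open>One bound B and one Lipschitz constant L serve f, r and q together; B thus also bounds
  the speed of the state.\<close>

locale bounded_lipschitz_control =
  fixes T M L B :: real
    and f :: "(real ^ 'n) \<times> (real ^ 'm) \<Rightarrow> (real ^ 'n)"
    and r :: "(real ^ 'n) \<times> (real ^ 'm) \<Rightarrow> real"
    and q :: "(real ^ 'n) \<Rightarrow> real"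
  assumes T_pos: "T > 0" and M_pos: "M > 0"
    and f_bound: "norm (f z) \<le> B" and f_lip: "L-lipschitz_on UNIV f"
    and r_bound: "\<bar>r z\<bar> \<le> B" and r_lip: "L-lipschitz_on UNIV r"
    and q_bound: "\<bar>q x\<bar> \<le> B" and q_lip: "L-lipschitz_on UNIV q"
begin

abbreviation "V \<equiv> value_function T M f r q"

definition process where
  "process t x0 u0 u x \<longleftrightarrow> u \<in> admissible_controls T M \<and> u t = u0 \<and> solves_state_eq f u t T x0 x"

definition cost where
  "cost t u x = integral {t..T} (\<lambda>s. r (x s, u s)) + q (x T)"

lemma L_nonneg: "L \<ge> 0" using f_lip by (rule lipschitz_on_nonneg)

lemma B_nonneg: "B \<ge> 0" using r_bound[of undefined] by linarith

lemma norm_f_diff_le: "norm (f (x, u) - f (y, v)) \<le> L * (norm (x - y) + norm (u - v))"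
  and norm_r_diff_le: "norm (r (x, u) - r (y, v)) \<le> L * (norm (x - y) + norm (u - v))"
proof -
  have "norm ((x, u) - (y, v)) \<le> norm (x - y) + norm (u - v)" by (simp add: norm_Pair_le)
  from mult_left_mono[OF this L_nonneg]
  show "norm (f (x, u) - f (y, v)) \<le> L * (norm (x - y) + norm (u - v))"
    "norm (r (x, u) - r (y, v)) \<le> L * (norm (x - y) + norm (u - v))"
    using lipschitz_on_normD[OF f_lip, of "(x, u)" "(y, v)"] lipschitz_on_normD[OF r_lip, of "(x, u)" "(y, v)"]
    by auto
qed

lemma q_diff_le: "\<bar>q x - q y\<bar> \<le> L * norm (x - y)"
  using lipschitz_on_normD[OF q_lip, of x y] by simp

lemma f_cont: "continuous_on S f" and r_cont: "continuous_on S r"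
  using lipschitz_on_continuous_on[OF f_lip] lipschitz_on_continuous_on[OF r_lip]
  by (auto elim: continuous_on_subset)

section \<open>Trajectories: existence, speed bounds, splitting of the cost\<close>

lemma process_has_vector_derivative:
  assumes "process t x0 u0 u x" "\<tau> \<in> S" "S \<subseteq> {t..T}"
  shows "(x has_vector_derivative f (x \<tau>, u \<tau>)) (at \<tau> within S)"
proof -
  have "(x has_vector_derivative f (x \<tau>, u \<tau>)) (at \<tau> within {t..T})"
    using assms unfolding process_def solves_state_eq_def by blast
  then show ?thesis using \<open>S \<subseteq> {t..T}\<close> by (rule has_vector_derivative_within_subset)
qed

lemma process_cont:
  assumes "process t x0 u0 u x" "0 \<le> t"
  shows "continuous_on {t..T} x" "continuous_on {t..T} u"
proof -
  show "continuous_on {t..T} x"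
    using assms unfolding process_def solves_state_eq_def
    by (meson continuous_on_eq_continuous_within has_vector_derivative_continuous)
  show "continuous_on {t..T} u"
    using assms unfolding process_def
    by (auto intro: continuous_on_subset[OF admissible_continuous_on])
qed

lemma process_r_integrable:
  assumes "process t x0 u0 u x" "0 \<le> t" "{a..b} \<subseteq> {t..T}"
  shows "(\<lambda>s. r (x s, u s)) integrable_on {a..b}"
  by (intro integrable_continuous_real continuous_on_compose2[OF r_cont[of UNIV]] continuous_intros
      continuous_on_subset[OF process_cont(1)[OF assms(1,2)] assms(3)]
      continuous_on_subset[OF process_cont(2)[OF assms(1,2)] assms(3)]) auto

lemma process_integral_le:
  assumes "process t x0 u0 u x" "0 \<le> t" "t \<le> a" "a \<le> b" "b \<le> T"
  shows "\<bar>integral {a..b} (\<lambda>s. r (x s, u s))\<bar> \<le> B * (b - a)"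
proof -
  have "norm (integral {a..b} (\<lambda>s. r (x s, u s))) \<le> integral {a..b} (\<lambda>s. B)"
    using assms r_bound
    by (intro integral_norm_bound_integral process_r_integrable[OF assms(1,2)]) auto
  then show ?thesis using assms by (simp add: mult.commute)
qed

lemma process_exists:
  assumes "u \<in> admissible_controls T M" "0 \<le> t" "t \<le> T"
  obtains x where "process t x0 (u t) u x"
proof -
  have "continuous_on {t..T} u"
    using assms admissible_continuous_on[OF assms(1)] by (elim continuous_on_subset) auto
  then have "continuous_on {t..T} (\<lambda>s. f (y s, u s))" if "continuous_on {t..T} y" for y
    using that by (auto intro!: continuous_on_compose2[OF f_cont[of UNIV]] continuous_intros)
  moreover have "norm (f (y, u s) - f (z, u s)) \<le> L * norm (y - z)" for s y z
    using norm_f_diff_le[of y "u s" z "u s"] by simp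
  ultimately obtain x where "x t = x0"
    "\<And>s. s \<in> {t..T} \<Longrightarrow> (x has_vector_derivative f (x s, u s)) (at s within {t..T})"
    using lipschitz_ode_exists[of t T "\<lambda>s y. f (y, u s)" L x0] L_nonneg \<open>t \<le> T\<close> by blast
  then show ?thesis using assms by (intro that[of x]) (auto simp: process_def solves_state_eq_def)
qed

lemma process_const_exists:
  assumes "0 \<le> t" "t \<le> T"
  obtains x where "process t x0 u0 (\<lambda>_. u0) x"
  using process_exists[OF _ assms, of "\<lambda>_. u0"] admissible_affine[of 0 M u0 0 T] M_pos by auto

lemma process_state_le:
  assumes "process t x0 u0 u x" "t \<le> s" "s \<le> T"
  shows "norm (x s - x0) \<le> B * (s - t)"
proof -
  have "norm (x s - x t) \<le> B * (s - t)"
  proof (rule vector_derivative_norm_diff_le[OF \<open>t \<le> s\<close>])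
    show "(x has_vector_derivative f (x \<tau>, u \<tau>)) (at \<tau> within {t..s})" if "\<tau> \<in> {t..s}" for \<tau>
      using assms that by (intro process_has_vector_derivative) auto
  qed (rule f_bound)
  then show ?thesis using assms by (simp add: process_def solves_state_eq_def)
qed

lemma process_control_le:
  assumes "process t x0 u0 u x" "0 \<le> t" "t \<le> s" "s \<le> T"
  shows "norm (u s - u0) \<le> M * (s - t)"
  using assms admissible_norm_diff_le[of u T M t s] by (auto simp: process_def)

lemma process_restrict:
  assumes "process t x0 u0 u x" "t \<le> t'" "t' \<le> T"
  shows "process t' (x t') (u t') u x"
  using assms unfolding process_def solves_state_eq_def
  by (auto intro: has_vector_derivative_within_subset[of x _ _ "{t..T}"])

lemma cost_split:
  assumes "process t x0 u0 u x" "0 \<le> t" "t \<le> t'" "t' \<le> T"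
  shows "cost t u x = integral {t..t'} (\<lambda>s. r (x s, u s)) + cost t' u x"
proof -
  have "integral {t..t'} (\<lambda>s. r (x s, u s)) + integral {t'..T} (\<lambda>s. r (x s, u s)) = integral {t..T} (\<lambda>s. r (x s, u s))"
    using assms by (intro Henstock_Kurzweil_Integration.integral_combine process_r_integrable[OF assms(1,2)]) auto
  then show ?thesis by (simp add: cost_def)
qed

lemma abs_cost_le:
  assumes "process t x0 u0 u x" "0 \<le> t" "t \<le> T"
  shows "\<bar>cost t u x\<bar> \<le> B * (T - t) + B"
  using process_integral_le[OF assms(1,2), of t T] assms q_bound[of "x T"] by (auto simp: cost_def)

section \<open>Bounds and terminal value of the infimum\<close>

lemma V_eq_Inf: "V (x0, u0, t) = Inf {cost t u x | u x. process t x0 u0 u x}"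
  by (simp add: value_function_def cost_def process_def)

lemma V_le_cost:
  assumes "process t x0 u0 u x" "0 \<le> t" "t \<le> T"
  shows "V (x0, u0, t) \<le> cost t u x"
  unfolding V_eq_Inf
proof (rule cInf_lower)
  show "bdd_below {cost t u x |u x. process t x0 u0 u x}"
    using abs_cost_le[of t x0 u0] assms by (intro bdd_belowI[of _ "- (B * (T - t) + B)"]) force
qed (use assms in auto)

text \<open>The infimum need not be attained, so lower bounds on V are derived from nearly optimal
  pairs.\<close>

lemma V_near_cost:
  assumes "0 \<le> t" "t \<le> T" "e > 0"
  obtains u x where "process t x0 u0 u x" "cost t u x < V (x0, u0, t) + e"
proof -
  let ?S = "{cost t u x |u x. process t x0 u0 u x}"
  have ne: "?S \<noteq> {}" using process_const_exists[OF assms(1,2)] by blast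
  have less: "Inf ?S < V (x0, u0, t) + e" using \<open>e > 0\<close> by (simp add: V_eq_Inf)
  obtain c where "c \<in> ?S" "c < V (x0, u0, t) + e" using cInf_lessD[OF ne less] by blast
  then show ?thesis using that by blast
qed

lemma abs_V_le:
  assumes "0 \<le> t" "t \<le> T"
  shows "\<bar>V (x0, u0, t)\<bar> \<le> B * T + B"
proof -
  obtain x where x: "process t x0 u0 (\<lambda>_. u0) x" using process_const_exists[OF assms] .
  have "B * (T - t) \<le> B * T" using B_nonneg assms by (intro mult_left_mono) auto
  then have le: "\<bar>cost t u x\<bar> \<le> B * T + B" if "process t x0 u0 u x" for u x
    using abs_cost_le[OF that assms] by linarith
  have "V (x0, u0, t) \<ge> - (B * T + B)"
  proof (rule field_le_epsilon)
    fix e :: real assume "e > 0"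
    obtain u x where "process t x0 u0 u x" "cost t u x < V (x0, u0, t) + e"
      using V_near_cost[OF assms \<open>e > 0\<close>] .
    then show "- (B * T + B) \<le> V (x0, u0, t) + e" using le by fastforce
  qed
  then show ?thesis using le[OF x] V_le_cost[OF x assms] by linarith
qed

lemma V_terminal: "V (x0, u0, T) = q x0"
proof (rule antisym)
  have cost: "cost T u x = q x0" if "process T x0 u0 u x" for u x
    using that by (simp add: cost_def process_def solves_state_eq_def)
  obtain x where x: "process T x0 u0 (\<lambda>_. u0) x" using process_const_exists[of T] T_pos by auto
  show "V (x0, u0, T) \<le> q x0" using V_le_cost[OF x] T_pos cost[OF x] by simp
  show "q x0 \<le> V (x0, u0, T)"
  proof (rule field_le_epsilon)
    fix e :: real assume "e > 0"
    obtain u x where "process T x0 u0 u x" "cost T u x < V (x0, u0, T) + e"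
      using V_near_cost[of T e x0 u0] T_pos \<open>e > 0\<close> by auto
    then show "q x0 \<le> V (x0, u0, T) + e" using cost by fastforce
  qed
qed

section \<open>Lipschitz dependence on the initial state and control\<close>

definition state_lip where "state_lip = L * T * (exp (3 * L * T) + 1) + L * exp (3 * L * T)"

lemma state_lip_nonneg: "state_lip \<ge> 0"
  using L_nonneg T_pos by (simp add: state_lip_def)

lemma V_state_le:
  assumes t: "0 \<le> t" "t \<le> T"
  shows "V (y0, v0, t) \<le> V (x0, u0, t) + state_lip * (norm (x0 - y0) + norm (u0 - v0))"
proof (rule field_le_epsilon)
  fix e :: real assume "e > 0"
  obtain u x where x: "process t x0 u0 u x" "cost t u x < V (x0, u0, t) + e"
    using V_near_cost[OF t \<open>e > 0\<close>] .
  \<comment> \<open>The translated control starts at v0 and keeps the derivative of u; its constant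
    distance d to u is the forcing term in the Gronwall estimate.\<close>
  define v where "v = (\<lambda>s. u s + (v0 - u0))"
  have v: "v \<in> admissible_controls T M" "v t = v0"
    using x(1) by (auto simp: v_def process_def intro: admissible_add_const)
  obtain y where y: "process t y0 v0 v y" using process_exists[OF v(1) t] v(2) by auto
  define d where "d = norm (u0 - v0)"
  define D where "D = norm (x0 - y0) + d"
  define Ex where "Ex = exp (3 * L * T)"
  have D: "D \<ge> 0" "d \<le> D" by (auto simp: D_def d_def)
  have uv: "norm (u s - v s) = d" for s by (simp add: v_def d_def norm_minus_commute)
  have Ex: "norm (x s - y s) \<le> Ex * D" if "s \<in> {t..T}" for s
  proof -
    have "norm (x s - y s) \<le> exp (3 * L * (T - t)) * (norm (x t - y t) + d)"
    proof (rule ode_gronwall[OF _ _ _ L_nonneg _ that])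
      show "norm (f (x s, u s) - f (y s, v s)) \<le> L * (norm (x s - y s) + d)" for s
        using norm_f_diff_le[of "x s" "u s" "y s" "v s"] by (simp add: uv)
    qed (use x y in \<open>auto simp: d_def process_def solves_state_eq_def\<close>)
    also have "norm (x t - y t) + d = D"
      using x y by (simp add: D_def process_def solves_state_eq_def)
    also have "exp (3 * L * (T - t)) \<le> Ex"
      using t L_nonneg by (simp add: Ex_def mult_left_mono)
    finally show ?thesis using D by (simp add: mult_right_mono)
  qed
  have "\<bar>integral {t..T} (\<lambda>s. r (y s, v s)) - integral {t..T} (\<lambda>s. r (x s, u s))\<bar> \<le> L * T * (Ex + 1) * D"
  proof -
    have int: "(\<lambda>s. r (y s, v s)) integrable_on {t..T}" "(\<lambda>s. r (x s, u s)) integrable_on {t..T}"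
      using process_r_integrable[OF y t(1)] process_r_integrable[OF x(1) t(1)] by auto
    have "norm (integral {t..T} (\<lambda>s. r (y s, v s) - r (x s, u s))) \<le> integral {t..T} (\<lambda>s. L * ((Ex + 1) * D))"
    proof (rule integral_norm_bound_integral[OF integrable_diff[OF int]])
      fix s assume "s \<in> {t..T}"
      have "norm (r (y s, v s) - r (x s, u s)) \<le> L * (norm (x s - y s) + d)"
        using norm_r_diff_le[of "y s" "v s" "x s" "u s"] uv[of s] by (simp add: norm_minus_commute)
      also have "\<dots> \<le> L * (Ex * D + D)"
        using Ex[OF \<open>s \<in> {t..T}\<close>] D L_nonneg by (intro mult_left_mono) auto
      finally show "norm (r (y s, v s) - r (x s, u s)) \<le> L * ((Ex + 1) * D)" by (simp add: algebra_simps)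
    qed auto
    also have "\<dots> = (T - t) * (L * ((Ex + 1) * D))" using t by simp
    also have "\<dots> \<le> T * (L * ((Ex + 1) * D))"
      using t D L_nonneg by (intro mult_right_mono) (auto simp: Ex_def)
    finally show ?thesis unfolding integral_diff[OF int] by (simp add: algebra_simps)
  qed
  moreover have "\<bar>q (y T) - q (x T)\<bar> \<le> L * (Ex * D)"
    using q_diff_le[of "y T" "x T"] mult_left_mono[OF Ex[of T] L_nonneg] t by (simp add: norm_minus_commute)
  \<comment> \<open>The first summand pays for the running cost over a time of at most T, with state
    gap at most Ex * D and control gap at most D; the second pays for the terminal cost.\<close>
  moreover have "state_lip * D = L * T * (Ex + 1) * D + L * (Ex * D)" by (simp add: state_lip_def Ex_def algebra_simps)
  ultimately have "cost t v y \<le> cost t u x + state_lip * D" unfolding cost_def by linarith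
  with V_le_cost[OF y t] x(2) have "V (y0, v0, t) \<le> V (x0, u0, t) + e + state_lip * D" by linarith
  then show "V (y0, v0, t) \<le> V (x0, u0, t) + state_lip * (norm (x0 - y0) + norm (u0 - v0)) + e"
    by (simp add: D_def d_def)
qed

section \<open>Dynamic programming and Lipschitz dependence on time\<close>

lemma dpp_near_optimal:
  assumes "0 \<le> t" "t \<le> t'" "t' \<le> T" "e > 0"
  obtains u x where "process t x0 u0 u x"
    "integral {t..t'} (\<lambda>s. r (x s, u s)) + V (x t', u t', t') < V (x0, u0, t) + e"
proof -
  have "t \<le> T" using assms by simp
  obtain u x where x: "process t x0 u0 u x" "cost t u x < V (x0, u0, t) + e"
    using V_near_cost[OF \<open>0 \<le> t\<close> \<open>t \<le> T\<close> \<open>e > 0\<close>] .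
  \<comment> \<open>The tail of the pair competes in the infimum at the point reached, so V there is
    at most the remaining cost.\<close>
  with V_le_cost[OF process_restrict[OF x(1) assms(2,3)]] assms cost_split[OF x(1) assms(1-3)]
  show ?thesis by (intro that[OF x(1)]) auto
qed

lemma process_concat:
  assumes p: "process t x0 u0 u x" and p': "process c (x c) (u c) v y"
    and c: "0 \<le> t" "t \<le> c" "c \<le> T"
  shows "process t x0 u0 (\<lambda>s. if s \<le> c then u s else v s) (\<lambda>s. if s \<le> c then x s else y s)"
    (is "process _ _ _ ?w ?z")
proof -
  have "(?z has_vector_derivative f (?z s, ?w s)) (at s within {t..T})" if s: "s \<in> {t..T}" for s
  proof -
    \<comment> \<open>The gluing rule speaks of closures of the two pieces. They meet only in c,
      where states and controls agree, hence also the two velocities.\<close>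
    have cl: "{t..c} \<union> {c} = {t..c}" "{c..T} \<union> {c} = {c..T}"
      "closure {t..c} \<inter> closure {c..T} = {c}"
      using c by auto
    have at_c: "v c = u c" "y c = x c" using p' by (auto simp: process_def solves_state_eq_def)
    have "((\<lambda>s. if s \<in> {t..c} then x s else y s) has_vector_derivative
        (if s \<in> {t..c} then f (x s, u s) else f (y s, v s))) (at s within {t..T})"
    proof (rule has_vector_derivative_If_within_closures[of s "{t..c}" "{c..T}" "{t..T}"
          x "\<lambda>s. f (x s, u s)" y "\<lambda>s. f (y s, v s)", unfolded cl])
      show "(x has_vector_derivative f (x s, u s)) (at s within {t..c})" if "s \<in> {t..c}"
        using that c by (intro process_has_vector_derivative[OF p]) auto
      show "(y has_vector_derivative f (y s, v s)) (at s within {c..T})" if "s \<in> {c..T}"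
        using that by (intro process_has_vector_derivative[OF p']) auto
      show "s \<in> {t..c} \<union> {c..T}" using s by auto
      show "{t..T} = {t..c} \<union> {c..T}" using c by auto
    qed (use at_c in auto)
    note * = this
    have "(?z has_vector_derivative (if s \<in> {t..c} then f (x s, u s) else f (y s, v s))) (at s within {t..T})"
      by (rule has_vector_derivative_transform[OF s _ *]) auto
    moreover have "(if s \<in> {t..c} then f (x s, u s) else f (y s, v s)) = f (?z s, ?w s)"
      using s by auto
    ultimately show ?thesis by (simp only:)
  qed
  moreover have "?w \<in> admissible_controls T M"
    using p p' c by (intro admissible_concat) (auto simp: process_def)
  ultimately show ?thesis
    using p c by (auto simp: process_def solves_state_eq_def)
qed

text \<open>The given pair is followed up to t' and continued by a nearly optimal pair from the
  point reached; the concatenation competes in the infimum at t.\<close>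

lemma dpp_le:
  assumes p: "process t x0 u0 u x" and t': "0 \<le> t" "t \<le> t'" "t' \<le> T"
  shows "V (x0, u0, t) \<le> integral {t..t'} (\<lambda>s. r (x s, u s)) + V (x t', u t', t')"
proof (rule field_le_epsilon)
  fix e :: real assume "e > 0"
  have "0 \<le> t'" using t' by simp
  obtain v y where y: "process t' (x t') (u t') v y" "cost t' v y < V (x t', u t', t') + e"
    using V_near_cost[OF \<open>0 \<le> t'\<close> \<open>t' \<le> T\<close> \<open>e > 0\<close>] .
  define w where "w = (\<lambda>s. if s \<le> t' then u s else v s)"
  define z where "z = (\<lambda>s. if s \<le> t' then x s else y s)"
  have z: "process t x0 u0 w z" unfolding w_def z_def by (rule process_concat[OF p y(1) t'])
  have at: "v t' = u t'" "y t' = x t'" using y(1) by (auto simp: process_def solves_state_eq_def)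
  have "V (x0, u0, t) \<le> cost t w z" using t' by (intro V_le_cost[OF z]) auto
  also have "\<dots> = integral {t..t'} (\<lambda>s. r (z s, w s)) + cost t' w z" using t' by (intro cost_split[OF z]) auto
  also have "integral {t..t'} (\<lambda>s. r (z s, w s)) = integral {t..t'} (\<lambda>s. r (x s, u s))"
    by (intro integral_cong) (auto simp: w_def z_def)
  also have "cost t' w z = cost t' v y"
  proof -
    \<comment> \<open>At s = t' the concatenation still takes its first branch; \<open>at\<close>
      supplies the agreement there.\<close>
    have "z s = y s" "w s = v s" if "s \<in> {t'..T}" for s using that at by (auto simp: w_def z_def)
    then show ?thesis unfolding cost_def using t' integral_cong[of "{t'..T}" "\<lambda>s. r (z s, w s)" "\<lambda>s. r (y s, v s)"]
      by simp
  qed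
  finally show "V (x0, u0, t) \<le> integral {t..t'} (\<lambda>s. r (x s, u s)) + V (x t', u t', t') + e"
    using y(2) by linarith
qed

text \<open>In time t' - t a pair moves by at most (B + M) * (t' - t), which changes V by at most
  \<open>state_lip\<close> times that, and the running cost contributes B * (t' - t). A constant
  control gives one inequality, a nearly optimal one the other.\<close>

lemma V_time_le:
  assumes t': "0 \<le> t" "t \<le> t'" "t' \<le> T"
  shows "\<bar>V (x0, u0, t) - V (x0, u0, t')\<bar> \<le> (B + state_lip * (B + M)) * (t' - t)"
proof -
  have est: "\<bar>integral {t..t'} (\<lambda>s. r (x s, u s)) + V (x t', u t', t') - V (x0, u0, t')\<bar>
      \<le> (B + state_lip * (B + M)) * (t' - t)" if p: "process t x0 u0 u x" for u x
  proof -
    have "norm (x t' - x0) + norm (u t' - u0) \<le> (B + M) * (t' - t)"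
      using process_state_le[OF p t'(2,3)] process_control_le[OF p t'] by (simp add: algebra_simps)
    from mult_left_mono[OF this state_lip_nonneg]
    have "\<bar>V (x t', u t', t') - V (x0, u0, t')\<bar> \<le> state_lip * ((B + M) * (t' - t))"
      using V_state_le[of t' "x t'" "u t'" x0 u0] V_state_le[of t' x0 u0 "x t'" "u t'"] t'
      by (simp add: norm_minus_commute)
    moreover have "\<bar>integral {t..t'} (\<lambda>s. r (x s, u s))\<bar> \<le> B * (t' - t)"
      using t' by (intro process_integral_le[OF p]) auto
    ultimately show ?thesis by (simp add: algebra_simps)
  qed
  have t: "t \<le> T" using t' by simp
  obtain x where x: "process t x0 u0 (\<lambda>_. u0) x" using process_const_exists[OF t'(1) t] .
  have "V (x0, u0, t) - V (x0, u0, t') \<le> (B + state_lip * (B + M)) * (t' - t)"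
    using est[OF x] dpp_le[OF x t'] by linarith
  moreover have "V (x0, u0, t') \<le> V (x0, u0, t) + (B + state_lip * (B + M)) * (t' - t)"
  proof (rule field_le_epsilon)
    fix e :: real assume "e > 0"
    obtain u x where x: "process t x0 u0 u x"
      "integral {t..t'} (\<lambda>s. r (x s, u s)) + V (x t', u t', t') < V (x0, u0, t) + e"
      using dpp_near_optimal[OF t' \<open>e > 0\<close>] .
    then show "V (x0, u0, t') \<le> V (x0, u0, t) + (B + state_lip * (B + M)) * (t' - t) + e"
      using est[OF x(1)] by linarith
  qed
  ultimately show ?thesis by linarith
qed

lemma V_lipschitz: "(B + state_lip * (B + M) + 2 * state_lip)-lipschitz_on (UNIV \<times> UNIV \<times> {0..T}) V"
proof (rule lipschitz_onI)
  let ?C = "B + state_lip * (B + M)"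
  have C: "?C \<ge> 0" using B_nonneg state_lip_nonneg M_pos by simp
  then show "0 \<le> ?C + 2 * state_lip" using state_lip_nonneg by linarith
  fix z z' :: "(real ^ 'n) \<times> (real ^ 'm) \<times> real"
  assume "z \<in> UNIV \<times> UNIV \<times> {0..T}" "z' \<in> UNIV \<times> UNIV \<times> {0..T}"
  then obtain x u t y v t' where z: "z = (x, u, t)" "z' = (y, v, t')" "t \<in> {0..T}" "t' \<in> {0..T}"
    by auto
  have d: "norm (x - y) \<le> dist z z'" "norm (u - v) \<le> dist z z'" "\<bar>t - t'\<bar> \<le> dist z z'"
    using dist_fst_le[of z z'] dist_snd_le[of z z'] dist_fst_le[of "snd z" "snd z'"]
      dist_snd_le[of "snd z" "snd z'"] by (auto simp: z dist_norm)
  have "\<bar>V (x, u, t) - V (x, u, t')\<bar> \<le> ?C * \<bar>t - t'\<bar>"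
    using V_time_le[of t t' x u] V_time_le[of t' t x u] z by (cases "t \<le> t'") (auto simp: abs_minus_commute)
  also have "\<dots> \<le> ?C * dist z z'" using d C by (intro mult_left_mono)
  finally have "\<bar>V (x, u, t) - V (x, u, t')\<bar> \<le> ?C * dist z z'" .
  moreover have "\<bar>V (x, u, t') - V (y, v, t')\<bar> \<le> state_lip * (norm (x - y) + norm (u - v))"
    using V_state_le[of t' x u y v] V_state_le[of t' y v x u] z by (simp add: norm_minus_commute)
  moreover have "state_lip * (norm (x - y) + norm (u - v)) \<le> state_lip * (2 * dist z z')"
    using d state_lip_nonneg by (intro mult_left_mono) auto
  ultimately show "dist (V z) (V z') \<le> (?C + 2 * state_lip) * dist z z'"
    by (simp add: z dist_real_def algebra_simps)
qed

section \<open>The value function is a viscosity solution\<close>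

lemma process_rates_close:
  assumes p: "process t x0 u0 u x" and s: "0 \<le> t" "t \<le> \<tau>" "\<tau> \<le> s" "s \<le> T"
  shows "norm (f (x \<tau>, u \<tau>) - f (x0, u0)) \<le> L * (B + M) * (s - t)"
    and "norm (r (x \<tau>, u \<tau>) - r (x0, u0)) \<le> L * (B + M) * (s - t)"
proof -
  have "norm (x \<tau> - x0) \<le> B * (\<tau> - t)" "norm (u \<tau> - u0) \<le> M * (\<tau> - t)"
    using process_state_le[OF p, of \<tau>] process_control_le[OF p, of \<tau>] s by auto
  then have "norm (x \<tau> - x0) + norm (u \<tau> - u0) \<le> (B + M) * (\<tau> - t)" by (simp add: algebra_simps)
  also have "\<dots> \<le> (B + M) * (s - t)" using B_nonneg M_pos s by (intro mult_left_mono) auto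
  finally have "L * (norm (x \<tau> - x0) + norm (u \<tau> - u0)) \<le> L * ((B + M) * (s - t))"
    using L_nonneg by (rule mult_left_mono)
  then show "norm (f (x \<tau>, u \<tau>) - f (x0, u0)) \<le> L * (B + M) * (s - t)"
    and "norm (r (x \<tau>, u \<tau>) - r (x0, u0)) \<le> L * (B + M) * (s - t)"
    using norm_f_diff_le[of "x \<tau>" "u \<tau>" x0 u0] norm_r_diff_le[of "x \<tau>" "u \<tau>" x0 u0] by (auto simp: mult.assoc)
qed

text \<open>Mean value inequality for the path minus a linear motion with the initial velocity. The
  error is independent of the control, as it must be when the control is chosen after the time
  step.\<close>

lemma process_state_expansion:
  assumes p: "process t x0 u0 u x" and s: "0 \<le> t" "t \<le> s" "s \<le> T"
  shows "norm (x s - x0 - (s - t) *\<^sub>R f (x0, u0)) \<le> L * (B + M) * (s - t)\<^sup>2"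
proof -
  let ?y = "\<lambda>\<tau>. x \<tau> - \<tau> *\<^sub>R f (x0, u0)"
  have "norm (?y s - ?y t) \<le> (L * (B + M) * (s - t)) * (s - t)"
  proof (rule vector_derivative_norm_diff_le[OF s(2)])
    show "(?y has_vector_derivative (f (x \<tau>, u \<tau>) - f (x0, u0))) (at \<tau> within {t..s})" if "\<tau> \<in> {t..s}" for \<tau>
    proof -
      have "(x has_vector_derivative f (x \<tau>, u \<tau>)) (at \<tau> within {t..s})"
        using that s by (intro process_has_vector_derivative[OF p]) auto
      then show ?thesis by (auto intro!: derivative_eq_intros)
    qed
  qed (use process_rates_close(1)[OF p s(1) _ _ s(3)] in auto)
  moreover have "?y s - ?y t = x s - x0 - (s - t) *\<^sub>R f (x0, u0)"
    using p by (simp add: process_def solves_state_eq_def algebra_simps)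
  ultimately show ?thesis using s by (simp add: power2_eq_square mult.assoc)
qed

lemma process_integral_expansion:
  assumes p: "process t x0 u0 u x" and s: "0 \<le> t" "t \<le> s" "s \<le> T"
  shows "\<bar>integral {t..s} (\<lambda>\<tau>. r (x \<tau>, u \<tau>)) - (s - t) * r (x0, u0)\<bar> \<le> L * (B + M) * (s - t)\<^sup>2"
proof -
  have int: "(\<lambda>\<tau>. r (x \<tau>, u \<tau>)) integrable_on {t..s}"
    using s by (intro process_r_integrable[OF p]) auto
  have "norm (integral {t..s} (\<lambda>\<tau>. r (x \<tau>, u \<tau>) - r (x0, u0))) \<le> integral {t..s} (\<lambda>\<tau>. L * (B + M) * (s - t))"
    using process_rates_close(2)[OF p s(1) _ _ s(3)] int
    by (intro integral_norm_bound_integral integrable_diff) auto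
  moreover have "integral {t..s} (\<lambda>\<tau>. r (x \<tau>, u \<tau>) - r (x0, u0))
      = integral {t..s} (\<lambda>\<tau>. r (x \<tau>, u \<tau>)) - (s - t) * r (x0, u0)"
    using s by (subst integral_diff[OF int]) auto
  ultimately show ?thesis using s by (simp add: power2_eq_square mult.commute mult.left_commute)
qed

text \<open>Along the path \<gamma> of an affine control, local maximality bounds the increase of V
  by that of R, while dynamic programming bounds the decrease of V by the running cost
  \<open>I\<close>. Hence R along \<gamma> plus \<open>I\<close> cannot decrease to the right of t0,
  so its right derivative is nonnegative for every v.\<close>

lemma V_subsolution:
  assumes t0: "t0 \<in> {0<..<T}" and max: "local_max_at (\<lambda>z. V z - R z) (x0, u0, t0)"
    and G: "GDERIV R (x0, u0, t0) :> (px, pu, pt)"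
  shows "hjb_expr M f r x0 u0 px pu pt \<ge> 0"
proof -
  have dir: "pt + px \<bullet> f (x0, u0) + pu \<bullet> v + r (x0, u0) \<ge> 0" if v: "norm v \<le> M" for v
  proof (rule ccontr)
    assume neg: "\<not> ?thesis"
    define u where "u = (\<lambda>s. u0 + (s - t0) *\<^sub>R v)"
    have u: "u \<in> admissible_controls T M" "u t0 = u0" unfolding u_def using admissible_affine[OF v] by auto
    have t: "0 \<le> t0" "t0 \<le> T" "t0 \<in> {t0..T}" using t0 by auto
    obtain x where x: "process t0 x0 u0 u x" using process_exists[OF u(1) t(1,2)] u(2) by auto
    have x_t0: "x t0 = x0" using x by (simp add: process_def solves_state_eq_def)
    define \<gamma> where "\<gamma> = (\<lambda>s. (x s, u s, s))"
    define I where "I = (\<lambda>s. integral {t0..s} (\<lambda>\<tau>. r (x \<tau>, u \<tau>)))"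
    have \<gamma>0: "\<gamma> t0 = (x0, u0, t0)" by (simp add: \<gamma>_def u x_t0)
    have "(x has_vector_derivative f (x0, u0)) (at t0 within {t0..T})"
      using x t by (auto simp: process_def solves_state_eq_def)
    moreover have "(u has_vector_derivative v) (at t0 within {t0..T})"
      unfolding u_def by (auto intro!: derivative_eq_intros)
    moreover have "((\<lambda>s. s) has_vector_derivative 1) (at t0 within {t0..T})"
      by (rule has_vector_derivative_id)
    ultimately have \<gamma>': "(\<gamma> has_vector_derivative (f (x0, u0), v, 1)) (at t0 within {t0..T})"
      unfolding \<gamma>_def by (intro has_vector_derivative_Pair)
    have "(R has_derivative (\<lambda>h. h \<bullet> (px, pu, pt))) (at (\<gamma> t0) within \<gamma> ` {t0..T})"
      using G unfolding gderiv_def \<gamma>0 by (rule has_derivative_at_withinI)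
    from has_derivative_in_compose[OF \<gamma>'[unfolded has_vector_derivative_def] this]
    have R': "((\<lambda>s. R (\<gamma> s)) has_real_derivative (pt + px \<bullet> f (x0, u0) + pu \<bullet> v)) (at t0 within {t0..T})"
      unfolding has_field_derivative_def
      by (rule has_derivative_eq_rhs) (auto simp: fun_eq_iff inner_commute algebra_simps)
    have "continuous_on {t0..T} (\<lambda>\<tau>. r (x \<tau>, u \<tau>))"
      by (intro continuous_on_compose2[OF r_cont[of UNIV]] continuous_intros process_cont[OF x t(1)]) auto
    from integral_has_vector_derivative[OF this t(3)]
    have "(I has_real_derivative r (x0, u0)) (at t0 within {t0..T})"
      unfolding I_def has_real_derivative_iff_has_vector_derivative by (simp add: x_t0 u)
    then have "((\<lambda>s. R (\<gamma> s) + I s) has_real_derivative (pt + px \<bullet> f (x0, u0) + pu \<bullet> v + r (x0, u0)))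
        (at t0 within {t0..T})"
      using R' by (rule DERIV_add[rotated])
    from has_real_derivative_neg_dec_right[OF this] neg
    obtain d where d: "d > 0" "\<And>h. h > 0 \<Longrightarrow> t0 + h \<in> {t0..T} \<Longrightarrow> h < d \<Longrightarrow> R (\<gamma> (t0 + h)) + I (t0 + h) < R (\<gamma> t0) + I t0"
      by auto
    have "(\<gamma> \<longlongrightarrow> \<gamma> t0) (at t0 within {t0..T})"
      using has_vector_derivative_continuous[OF \<gamma>'] by (simp add: continuous_within)
    then have "\<forall>\<^sub>F s in at t0 within {t0..T}. V (\<gamma> s) - R (\<gamma> s) \<le> V (\<gamma> t0) - R (\<gamma> t0)"
      using max unfolding local_max_at_def \<gamma>0 by (rule eventually_compose_filterlim[rotated])
    then obtain d' where d': "d' > 0" "\<And>s. s \<in> {t0..T} \<Longrightarrow> s \<noteq> t0 \<Longrightarrow> dist s t0 < d' \<Longrightarrow>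
        V (\<gamma> s) - R (\<gamma> s) \<le> V (\<gamma> t0) - R (\<gamma> t0)"
      unfolding eventually_at by blast
    define h where "h = min (min (d / 2) (d' / 2)) (T - t0)"
    have h: "h > 0" "h < d" "h < d'" "t0 + h \<le> T" using d(1) d'(1) t0 by (auto simp: h_def)
    have "R (\<gamma> (t0 + h)) + I (t0 + h) < R (\<gamma> t0)"
      using d(2)[of h] h by (simp add: I_def)
    moreover have "V (\<gamma> (t0 + h)) - R (\<gamma> (t0 + h)) \<le> V (\<gamma> t0) - R (\<gamma> t0)"
      using d'(2)[of "t0 + h"] h by (simp add: dist_real_def)
    moreover have "V (\<gamma> t0) \<le> I (t0 + h) + V (\<gamma> (t0 + h))"
      unfolding \<gamma>0 I_def using dpp_le[OF x, of "t0 + h"] h t by (simp add: \<gamma>_def)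
    ultimately show False by linarith
  qed
  \<comment> \<open>The minimizer of pu . v over the ball of radius M; as sgn 0 = 0, it also covers
    pu = 0.\<close>
  define v where "v = - (M *\<^sub>R sgn pu)"
  have "norm v \<le> M" using M_pos by (simp add: v_def norm_sgn)
  moreover have "pu \<bullet> v = - (M * norm pu)"
    by (cases "pu = 0") (simp_all add: v_def sgn_div_norm power2_norm_eq_inner[symmetric] power2_eq_square)
  ultimately show ?thesis using dir[of v] by (simp add: hjb_expr_def)
qed

text \<open>Local minimality bounds the change of V from below by that of R; a nearly optimal pair
  bounds it from above by the slack minus the running cost. The unknown control displacement
  contributes at least - M * h * norm pu, so an excess E > 0 outweighs all errors.\<close>

lemma V_supersolution:
  assumes t0: "t0 \<in> {0<..<T}" and min: "local_min_at (\<lambda>z. V z - R z) (x0, u0, t0)"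
    and G: "GDERIV R (x0, u0, t0) :> (px, pu, pt)"
  shows "hjb_expr M f r x0 u0 px pu pt \<le> 0"
proof (rule ccontr)
  define E where "E = hjb_expr M f r x0 u0 px pu pt"
  assume "\<not> ?thesis"
  then have "E > 0" by (simp add: E_def)
  \<comment> \<open>State, control and time together move by at most C * h; the summand 1 is for
    time.\<close>
  define C where "C = B + M + 1"
  have C: "C > 0" using B_nonneg M_pos by (simp add: C_def)
  define z0 where "z0 = (x0, u0, t0)"
  define e where "e = E / (4 * C)"
  have e: "e > 0" "e * C = E / 4" using \<open>E > 0\<close> C by (auto simp: e_def)
  obtain d where d: "d > 0" "\<And>z. norm (z - z0) < d \<Longrightarrow> norm (R z - R z0 - (z - z0) \<bullet> (px, pu, pt)) \<le> e * norm (z - z0)"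
    using G e(1) unfolding gderiv_def has_derivative_at_alt z0_def by blast
  obtain d' where d': "d' > 0" "\<And>z. dist z z0 < d' \<Longrightarrow> V z0 - R z0 \<le> V z - R z"
    using min unfolding local_min_at_def eventually_nhds_metric z0_def by blast
  define A where "A = L * (B + M)"
  have A: "A \<ge> 0" using L_nonneg B_nonneg M_pos by (simp add: A_def)
  \<comment> \<open>Error budget: the remainder of R, the slack of near-optimality and the two
    expansion errors together are allowed E / 4 * h each, in total less than E * h. The first two
    entries keep the end point in the neighbourhoods of radius d and d', the third keeps it before
    T.\<close>
  define h where "h = Min {d / (2 * C), d' / (2 * C), T - t0, E / (4 * (A * (norm px + 1) + 1))}"
  have pos: "A * (norm px + 1) + 1 > 0" using A by (simp add: add_nonneg_pos)
  have h: "h > 0" "h \<le> d / (2 * C)" "h \<le> d' / (2 * C)" "h \<le> T - t0" "h \<le> E / (4 * (A * (norm px + 1) + 1))"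
    unfolding h_def using d d' C t0 \<open>E > 0\<close> pos by auto
  have hC: "C * h < d" "C * h < d'"
    using h(2,3) C d(1) d'(1) by (auto simp: field_simps)
  have hA: "A * (norm px + 1) * h \<le> E / 4"
  proof -
    have "(A * (norm px + 1) + 1) * h \<le> E / 4" using h(5) pos by (simp add: field_simps)
    then show ?thesis using h(1) by (simp add: algebra_simps)
  qed
  have t: "0 \<le> t0" "t0 \<le> t0 + h" "t0 + h \<le> T" using t0 h by auto
  have "E / 4 * h > 0" using \<open>E > 0\<close> h by simp
  obtain u x where x: "process t0 x0 u0 u x"
    "integral {t0..t0 + h} (\<lambda>s. r (x s, u s)) + V (x (t0 + h), u (t0 + h), t0 + h) < V (x0, u0, t0) + E / 4 * h"
    using dpp_near_optimal[OF t \<open>E / 4 * h > 0\<close>] .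
  define z where "z = (x (t0 + h), u (t0 + h), t0 + h)"
  define \<xi> where "\<xi> = x (t0 + h) - x0"
  define \<eta> where "\<eta> = u (t0 + h) - u0"
  have z: "z - z0 = (\<xi>, \<eta>, h)" by (simp add: z_def z0_def \<xi>_def \<eta>_def)
  have b: "norm \<xi> \<le> B * h" "norm \<eta> \<le> M * h"
    using process_state_le[OF x(1) t(2,3)] process_control_le[OF x(1) t] by (auto simp: \<xi>_def \<eta>_def)
  have zz: "norm (z - z0) \<le> C * h"
    using norm_triple_le[of \<xi> \<eta> h] b h(1) unfolding z C_def by (simp add: algebra_simps)
  have "norm (R z - R z0 - (z - z0) \<bullet> (px, pu, pt)) \<le> e * norm (z - z0)"
    using zz hC by (intro d(2)) linarith
  also have "\<dots> \<le> e * (C * h)" using zz e by (intro mult_left_mono) auto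
  also have "\<dots> = E / 4 * h" using e(2) by (simp flip: mult.assoc)
  finally have 1: "R z - R z0 \<ge> \<xi> \<bullet> px + \<eta> \<bullet> pu + h * pt - E / 4 * h"
    unfolding z inner_Pair real_norm_def inner_real_def by linarith
  have 2: "V z0 - R z0 \<le> V z - R z" using zz hC by (intro d'(2)) (simp add: dist_norm)
  have "norm (\<xi> - h *\<^sub>R f (x0, u0)) \<le> A * h\<^sup>2"
    using process_state_expansion[OF x(1) t] by (simp add: \<xi>_def A_def)
  then have "- (norm px * (A * h\<^sup>2)) \<le> (\<xi> - h *\<^sub>R f (x0, u0)) \<bullet> px"
    using Cauchy_Schwarz_ineq2[of "\<xi> - h *\<^sub>R f (x0, u0)" px]
      mult_left_mono[of "norm (\<xi> - h *\<^sub>R f (x0, u0))" "A * h\<^sup>2" "norm px"]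
    by (simp add: mult.commute abs_le_iff)
  then have 3: "\<xi> \<bullet> px \<ge> h * (px \<bullet> f (x0, u0)) - norm px * (A * h\<^sup>2)"
    by (simp add: inner_diff_left inner_commute[of px])
  have "norm \<eta> * norm pu \<le> M * h * norm pu" using b(2) by (rule mult_right_mono) simp
  then have 4: "\<eta> \<bullet> pu \<ge> - (M * h * norm pu)"
    using Cauchy_Schwarz_ineq2[of \<eta> pu] by linarith
  have 5: "integral {t0..t0 + h} (\<lambda>s. r (x s, u s)) \<ge> h * r (x0, u0) - A * h\<^sup>2"
    using process_integral_expansion[OF x(1) t] by (simp add: A_def abs_le_iff)
  have 6: "integral {t0..t0 + h} (\<lambda>s. r (x s, u s)) + V z < V z0 + E / 4 * h"
    using x(2) by (simp add: z_def z0_def)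
  have "h * (px \<bullet> f (x0, u0)) - norm px * (A * h\<^sup>2) - M * h * norm pu + h * pt - E / 4 * h + h * r (x0, u0) - A * h\<^sup>2
      < E / 4 * h"
    using 1 2 3 4 5 6 by linarith
  moreover have "h * E = h * (px \<bullet> f (x0, u0)) - M * h * norm pu + h * pt + h * r (x0, u0)"
    by (simp add: E_def hjb_expr_def algebra_simps)
  moreover have "(A * (norm px + 1) * h) * h = norm px * (A * h\<^sup>2) + A * h\<^sup>2"
    by (simp add: algebra_simps power2_eq_square)
  ultimately have "h * E < E / 2 * h + (A * (norm px + 1) * h) * h"
    by linarith
  also have "\<dots> \<le> E / 2 * h + E / 4 * h" using hA h(1) by (intro add_left_mono mult_right_mono) auto
  finally have "h * E < h * (3 / 4 * E)" by (simp add: algebra_simps)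
  then show False using h(1) \<open>E > 0\<close> by simp
qed

lemma V_viscosity_solution: "hjb_viscosity_solution T M f r q V"
  unfolding hjb_viscosity_solution_def
proof (intro conjI allI ballI impI)
  show "continuous_on (UNIV \<times> UNIV \<times> {0..T}) V"
    using V_lipschitz by (rule lipschitz_on_continuous_on)
qed (fact V_terminal, erule (2) V_subsolution, erule (2) V_supersolution)

end

section \<open>Comparison principle\<close>

text \<open>The penalty localizes the comparison argument to the domain of dependence of
  \<^term>\<open>(x0, u0, t0)\<close>: the exponential part satisfies
  \<open>\<partial>\<^sub>t\<psi> + C \<bar>\<nabla>\<psi>\<bar> \<le> 0\<close> for the propagation speed \<open>C\<close>, and is small at the vertex and
  huge at the lateral boundary of a large box when \<open>N\<close> is large; the term \<open>h / t\<close> keeps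
  maximizers away from \<open>t = 0\<close> and makes the inequality strict.\<close>

definition cone_radius where
  "cone_radius x0 u0 z =
     sqrt (1 + (fst z - x0) \<bullet> (fst z - x0) + (fst (snd z) - u0) \<bullet> (fst (snd z) - u0))"

text \<open>The 1 under the root makes \<open>cone_radius\<close> smooth and equal to 1 at the
  vertex, so the exponent there is - N. For 0 \<le> C, 0 \<le> t0, 0 \<le> N and times up to T, it
  is at least N as soon as the radius reaches C * T + 3.\<close>

definition cone_exp where
  "cone_exp C N x0 u0 t0 z = exp (N * (cone_radius x0 u0 z - C * (snd (snd z) - t0) - 2))"

definition cone_penalty where
  "cone_penalty C N h x0 u0 t0 z = cone_exp C N x0 u0 t0 z + h / snd (snd z)"

definition cone_penalty_grad where
  "cone_penalty_grad C N h x0 u0 t0 z =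
     ((N * cone_exp C N x0 u0 t0 z / cone_radius x0 u0 z) *\<^sub>R (fst z - x0),
      (N * cone_exp C N x0 u0 t0 z / cone_radius x0 u0 z) *\<^sub>R (fst (snd z) - u0),
      - (N * C * cone_exp C N x0 u0 t0 z) - h / (snd (snd z))\<^sup>2)"

lemma cone_radius_pos:
  "1 + (fst z - x0) \<bullet> (fst z - x0) + (fst (snd z) - u0) \<bullet> (fst (snd z) - u0) > 0"
  "cone_radius x0 u0 z > 0"
  "cone_radius x0 u0 z \<noteq> 0"
proof -
  show "1 + (fst z - x0) \<bullet> (fst z - x0) + (fst (snd z) - u0) \<bullet> (fst (snd z) - u0) > 0"
    by (intro add_pos_nonneg) auto
  then show "cone_radius x0 u0 z > 0" "cone_radius x0 u0 z \<noteq> 0" by (simp_all add: cone_radius_def)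
qed

lemma norm_le_cone_radius:
  "norm (fst z - x0) \<le> cone_radius x0 u0 z" "norm (fst (snd z) - u0) \<le> cone_radius x0 u0 z"
  by (auto simp: cone_radius_def norm_eq_sqrt_inner add_nonneg_nonneg)

lemma GDERIV_cone_penalty:
  assumes "snd (snd z) \<noteq> 0"
  shows "GDERIV (cone_penalty C N h x0 u0 t0) z :> cone_penalty_grad C N h x0 u0 t0 z"
proof -
  have rad: "((\<lambda>z. cone_radius x0 u0 z) has_derivative
      (\<lambda>v. (fst v \<bullet> (fst z - x0) + fst (snd v) \<bullet> (fst (snd z) - u0)) / cone_radius x0 u0 z)) (at z)"
    unfolding cone_radius_def using cone_radius_pos(1)[of z x0 u0]
    by (auto intro!: derivative_eq_intros simp: fun_eq_iff inner_commute field_simps)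
  have exp: "((\<lambda>z. cone_exp C N x0 u0 t0 z) has_derivative
      (\<lambda>v. cone_exp C N x0 u0 t0 z * (N * ((fst v \<bullet> (fst z - x0) + fst (snd v) \<bullet> (fst (snd z) - u0)) / cone_radius x0 u0 z
         - C * snd (snd v))))) (at z)"
    unfolding cone_exp_def by (auto intro!: derivative_eq_intros rad simp: fun_eq_iff)
  have quot: "((\<lambda>z. h / snd (snd z)) has_derivative (\<lambda>v. - (h * snd (snd v) / (snd (snd z))\<^sup>2))) (at z)"
    using assms by (auto intro!: derivative_eq_intros simp: fun_eq_iff power2_eq_square field_simps)
  define X where "X = fst z - x0"
  define Y where "Y = fst (snd z) - u0"
  show ?thesis
    unfolding gderiv_def cone_penalty_def
    by (rule has_derivative_eq_rhs[OF has_derivative_add[OF exp quot]])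
       (auto simp: fun_eq_iff cone_penalty_grad_def algebra_simps add_divide_distrib
         simp flip: X_def Y_def)
qed

lemma continuous_on_cone_radius: "continuous_on S (cone_radius x0 u0)"
  unfolding cone_radius_def by (intro continuous_intros)

lemma continuous_on_cone_exp: "continuous_on S (cone_exp C N x0 u0 t0)"
  unfolding cone_exp_def by (intro continuous_intros continuous_on_cone_radius)

lemma continuous_on_cone_penalty:
  assumes "\<And>z. z \<in> S \<Longrightarrow> snd (snd z) \<noteq> 0"
  shows "continuous_on S (cone_penalty C N h x0 u0 t0)"
  unfolding cone_penalty_def by (intro continuous_intros continuous_on_cone_exp) (use assms in auto)

lemma continuous_on_cone_penalty_grad:
  assumes "\<And>z. z \<in> S \<Longrightarrow> snd (snd z) \<noteq> 0"
  shows "continuous_on S (cone_penalty_grad C N h x0 u0 t0)"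
  unfolding cone_penalty_grad_def
  by (intro continuous_intros continuous_on_cone_exp continuous_on_cone_radius)
     (use assms in \<open>auto simp: cone_radius_pos(3)\<close>)

lemma norm_scaled_le:
  assumes "0 \<le> a" "0 < c" "norm w \<le> c"
  shows "norm ((a / c) *\<^sub>R w) \<le> a"
  using mult_left_mono[OF assms(3,1)] assms by (simp add: field_simps)

text \<open>For C = B + M these bounds let the first term of s absorb B * norm p + M * norm q, which
  leaves - h / t^2.\<close>

lemma cone_penalty_grad_bounds:
  assumes "N \<ge> 0" "cone_penalty_grad C N h x0 u0 t0 z = (p, q, s)"
  shows "norm p \<le> N * cone_exp C N x0 u0 t0 z" "norm q \<le> N * cone_exp C N x0 u0 t0 z"
    "s = - (C * (N * cone_exp C N x0 u0 t0 z)) - h / (snd (snd z))\<^sup>2"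
proof -
  define a where "a = N * cone_exp C N x0 u0 t0 z"
  have a: "a \<ge> 0" using \<open>N \<ge> 0\<close> by (simp add: a_def cone_exp_def)
  have eqs: "p = (a / cone_radius x0 u0 z) *\<^sub>R (fst z - x0)" "q = (a / cone_radius x0 u0 z) *\<^sub>R (fst (snd z) - u0)"
    "s = - (C * a) - h / (snd (snd z))\<^sup>2"
    using assms(2) by (auto simp: cone_penalty_grad_def a_def)
  then show "norm p \<le> N * cone_exp C N x0 u0 t0 z" "norm q \<le> N * cone_exp C N x0 u0 t0 z"
    "s = - (C * (N * cone_exp C N x0 u0 t0 z)) - h / (snd (snd z))\<^sup>2"
    using norm_scaled_le[OF a cone_radius_pos(2)] norm_le_cone_radius unfolding a_def by metis+
qed

section \<open>Doubling of variables\<close>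

lemma GDERIV_sq_dist:
  "GDERIV (\<lambda>z. k * ((z - a) \<bullet> (z - a))) z :> (2 * k) *\<^sub>R (z - a)"
  unfolding gderiv_def
  by (auto intro!: derivative_eq_intros simp: fun_eq_iff inner_commute algebra_simps)

context bounded_lipschitz_control
begin

text \<open>The shared momentum px, of size k * D, meets a difference of f of order L * D; this is
  the source of k * D^2. The extra gradients enter only through the bound on f and the control speed
  M.\<close>

lemma hjb_expr_doubling:
  fixes x y :: "real ^ 'n" and u v :: "real ^ 'm"
  assumes "norm (x - y) \<le> D" "norm (u - v) \<le> D" "norm px \<le> k * D" "k \<ge> 0"
  shows "hjb_expr M f r x u (px + gx) (pu + gu) (pt + gt) - hjb_expr M f r y v px pu pt
    \<le> gt + B * norm gx + M * norm gu + 2 * L * k * D\<^sup>2 + 2 * L * D"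
proof -
  have D: "D \<ge> 0" using assms(1) norm_ge_zero order_trans by blast
  have d: "L * (norm (x - y) + norm (u - v)) \<le> L * (2 * D)"
    using assms L_nonneg by (intro mult_left_mono) auto
  have "px \<bullet> (f (x, u) - f (y, v)) \<le> norm px * norm (f (x, u) - f (y, v))"
    by (rule norm_cauchy_schwarz)
  also have "\<dots> \<le> (k * D) * (L * (2 * D))"
    using assms D norm_f_diff_le[of x u y v] d by (intro mult_mono) auto
  finally have 1: "px \<bullet> f (x, u) - px \<bullet> f (y, v) \<le> 2 * L * k * D\<^sup>2"
    by (simp add: inner_diff_right power2_eq_square algebra_simps)
  have "gx \<bullet> f (x, u) \<le> norm gx * norm (f (x, u))" by (rule norm_cauchy_schwarz)
  also have "\<dots> \<le> norm gx * B" using f_bound by (intro mult_left_mono) auto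
  finally have 2: "gx \<bullet> f (x, u) \<le> B * norm gx" by (simp add: mult.commute)
  have "norm pu \<le> norm (pu + gu) + norm gu" using norm_triangle_ineq4[of "pu + gu" gu] by simp
  then have "M * norm pu \<le> M * (norm (pu + gu) + norm gu)" using M_pos by (intro mult_left_mono) auto
  then have 3: "M * norm pu - M * norm (pu + gu) \<le> M * norm gu" by (simp add: algebra_simps)
  have 4: "r (x, u) - r (y, v) \<le> 2 * L * D"
    using norm_r_diff_le[of x u y v] d by (simp add: abs_le_iff)
  show ?thesis using 1 2 3 4 by (simp add: hjb_expr_def inner_add_left)
qed

text \<open>W1 is tested at z and W2 at z'. Both quadratic test functions have gradient 2 k (z - z')
  at their points, so the momenta differ only by the cone penalty. Its exponential part drops out,
  and h / t^2 \<ge> h / T^2 survives.\<close>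

lemma doubling_contradiction:
  assumes W1: "hjb_viscosity_solution T M f r q W1" and W2: "hjb_viscosity_solution T M f r q W2"
    and z: "snd (snd z) \<in> {0<..<T}" and z': "snd (snd z') \<in> {0<..<T}"
    and max: "local_max_at (\<lambda>w. W1 w - (k * ((w - z') \<bullet> (w - z')) + cone_penalty (B + M) N h x0 u0 t0 w)) z"
    and min: "local_min_at (\<lambda>w. W2 w - (- k) * ((w - z) \<bullet> (w - z))) z'"
    and k: "k \<ge> 0" and N: "N \<ge> 0" and h: "h \<ge> 0"
  shows "h / T\<^sup>2 \<le> 4 * L * k * (norm (z - z'))\<^sup>2 + 2 * L * norm (z - z')"
proof -
  obtain x u t where zz: "z = (x, u, t)" by (cases z) auto
  obtain y v s where zz': "z' = (y, v, s)" by (cases z') auto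
  let ?S = "UNIV \<times> UNIV \<times> {0<..<T} :: ((real ^ 'n) \<times> (real ^ 'm) \<times> real) set"
  let ?G = "cone_penalty_grad (B + M) N h x0 u0 t0"
  obtain gx gu gt where g: "?G z = (gx, gu, gt)" by (cases "?G z") auto
  define p where "p = (2 * k) *\<^sub>R (z - z')"
  have p: "p = ((2 * k) *\<^sub>R (x - y), (2 * k) *\<^sub>R (u - v), (2 * k) * (t - s))" by (simp add: p_def zz zz')
  let ?R1 = "\<lambda>w. k * ((w - z') \<bullet> (w - z')) + cone_penalty (B + M) N h x0 u0 t0 w"
  have R1: "GDERIV ?R1 w :> (2 * k) *\<^sub>R (w - z') + ?G w" if "w \<in> ?S" for w
    using that by (intro GDERIV_add GDERIV_sq_dist GDERIV_cone_penalty) auto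
  have "continuous_on ?S (\<lambda>w. (2 * k) *\<^sub>R (w - z') + ?G w)"
    by (intro continuous_intros continuous_on_cone_penalty_grad) auto
  then have "C1_on ?S ?R1" unfolding C1_on_def using R1 by blast
  moreover have "GDERIV ?R1 (x, u, t) :> ((2 * k) *\<^sub>R (x - y) + gx, (2 * k) *\<^sub>R (u - v) + gu, (2 * k) * (t - s) + gt)"
    using R1[of z] z g p by (simp add: zz p_def)
  ultimately have 1: "hjb_expr M f r x u ((2 * k) *\<^sub>R (x - y) + gx) ((2 * k) *\<^sub>R (u - v) + gu) ((2 * k) * (t - s) + gt) \<ge> 0"
    using W1 max z unfolding hjb_viscosity_solution_def zz by simp
  let ?R2 = "\<lambda>w. (- k) * ((w - z) \<bullet> (w - z))"
  have R2: "GDERIV ?R2 w :> (2 * (- k)) *\<^sub>R (w - z)" for w by (rule GDERIV_sq_dist)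
  have "continuous_on ?S (\<lambda>w. (2 * (- k)) *\<^sub>R (w - z))" by (intro continuous_intros)
  then have "C1_on ?S ?R2" unfolding C1_on_def using R2 by blast
  moreover have "GDERIV ?R2 (y, v, s) :> ((2 * k) *\<^sub>R (x - y), (2 * k) *\<^sub>R (u - v), (2 * k) * (t - s))"
    using R2[of z'] by (simp add: zz zz' algebra_simps)
  ultimately have 2: "hjb_expr M f r y v ((2 * k) *\<^sub>R (x - y)) ((2 * k) *\<^sub>R (u - v)) ((2 * k) * (t - s)) \<le> 0"
    using W2 min z' unfolding hjb_viscosity_solution_def zz' by simp
  define D where "D = norm (z - z')"
  have D: "norm (x - y) \<le> D" "norm (u - v) \<le> D"
    using norm_fst_le[of "x - y" "(u - v, t - s)"] norm_fst_le[of "u - v" "t - s"]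
      norm_snd_le[where x = "x - y" and y = "(u - v, t - s)"]
    by (auto simp: D_def zz zz')
  \<comment> \<open>The momentum carries the factor 2 k, which takes the place of k in
    \<open>hjb_expr_doubling\<close>.\<close>
  have "norm ((2 * k) *\<^sub>R (x - y)) \<le> (2 * k) * D" using D(1) k by (simp add: mult_left_mono)
  from hjb_expr_doubling[OF D this, of gx "(2 * k) *\<^sub>R (u - v)" gu "2 * k * (t - s)" gt] 1 2 k
  have "0 \<le> gt + B * norm gx + M * norm gu + 2 * L * (2 * k) * D\<^sup>2 + 2 * L * D" by linarith
  moreover define a where "a = N * cone_exp (B + M) N x0 u0 t0 z"
  have "B * norm gx \<le> B * a" "M * norm gu \<le> M * a" "gt = - ((B + M) * a) - h / t\<^sup>2"
    using cone_penalty_grad_bounds[OF N g] B_nonneg M_pos by (auto simp: a_def zz mult_left_mono)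
  moreover have "h / T\<^sup>2 \<le> h / t\<^sup>2"
    using z h by (intro divide_left_mono power_mono) (auto simp: zz)
  ultimately show ?thesis unfolding D_def[symmetric] by (simp add: algebra_simps)
qed

lemma comparison_interior:
  assumes W1: "hjb_viscosity_solution T M f r q W1" and W2: "hjb_viscosity_solution T M f r q W2"
    and t0: "t0 \<in> {0<..<T}"
  shows "W1 (x0, u0, t0) \<le> W2 (x0, u0, t0)"
proof (rule ccontr)
  assume gap: "\<not> ?thesis"
  define z0 where "z0 = (x0, u0, t0)"
  \<comment> \<open>At the vertex the penalty costs at most 2 * \<delta>: one \<delta> for
    \<open>exp (- N)\<close> and one for h / t0. The third \<delta> remains as a positive value of
    the doubled function.\<close>
  define \<delta> where "\<delta> = (W1 z0 - W2 z0) / 3"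
  have \<delta>: "\<delta> > 0" "W1 z0 - W2 z0 = 3 * \<delta>" using gap by (auto simp: \<delta>_def z0_def)
  define h where "h = \<delta> * t0"
  have h: "h > 0" using \<delta> t0 by (simp add: h_def)
  define C where "C = B + M"
  have C: "C \<ge> 0" using B_nonneg M_pos by (simp add: C_def)
  define P where "P = C * T + 3"
  have P: "P > 0" using C T_pos by (simp add: P_def add_nonneg_pos)
  \<comment> \<open>The initial time stays a parameter: S is taken over the box starting at 0, and
    the final initial time a is then computed from S.\<close>
  let ?box = "\<lambda>a. cball x0 P \<times> cball u0 P \<times> {a..T}"
  have cont: "continuous_on (?box a) W1" "continuous_on (?box a) W2" if "0 \<le> a" for a
    using W1 W2 that unfolding hjb_viscosity_solution_def by (auto elim!: continuous_on_subset)
  have compact: "compact (?box a)" for a by (intro compact_Times compact_cball compact_Icc)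
  obtain S1 where S1: "\<And>z. z \<in> ?box 0 \<Longrightarrow> \<bar>W1 z\<bar> \<le> S1"
    using compact_imp_bounded[OF compact_continuous_image[OF cont(1)[OF order_refl] compact]]
    unfolding bounded_iff by auto
  obtain S2 where S2: "\<And>z. z \<in> ?box 0 \<Longrightarrow> \<bar>W2 z\<bar> \<le> S2"
    using compact_imp_bounded[OF compact_continuous_image[OF cont(2)[OF order_refl] compact]]
    unfolding bounded_iff by auto
  define S where "S = \<bar>S1\<bar> + \<bar>S2\<bar> + 1"
  have S: "S > 0" "\<And>z z'. z \<in> ?box 0 \<Longrightarrow> z' \<in> ?box 0 \<Longrightarrow> W1 z - W2 z' \<le> S"
    using S1 S2 by (force simp: S_def)+
  define N where "N = max (S + \<delta>) (1 / \<delta>)"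
  have N: "N \<ge> 0" "S + \<delta> \<le> N" "1 / \<delta> \<le> N" using S(1) \<delta> by (auto simp: N_def)
  have exp_N: "exp N > S + \<delta>" "exp (- N) \<le> \<delta>"
  proof -
    show "exp N > S + \<delta>" using exp_ge_add_one_self[of N] N by linarith
    have "1 / \<delta> \<le> exp N" using exp_ge_add_one_self[of N] N by linarith
    then show "exp (- N) \<le> \<delta>" using \<delta>(1) by (simp add: exp_minus field_simps)
  qed
  define \<psi> where "\<psi> = cone_penalty C N h x0 u0 t0"
  \<comment> \<open>At time a the term h / t alone equals S + \<delta>, more than a maximizer can
    afford.\<close>
  define a where "a = h / (S + \<delta>)"
  have a: "a > 0" "a \<le> t0" "h / a = S + \<delta>"
  proof -
    show "a > 0" "h / a = S + \<delta>" using h S(1) \<delta>(1) by (auto simp: a_def)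
    show "a \<le> t0" using S(1) \<delta>(1) t0 by (simp add: a_def h_def field_simps)
  qed
  have \<psi>_nonneg: "\<psi> z \<ge> 0" if "z \<in> ?box a" for z
    using that h a(1) by (auto simp: \<psi>_def cone_penalty_def cone_exp_def)
  have "\<psi> z0 \<le> 2 * \<delta>"
    using exp_N t0 by (simp add: \<psi>_def z0_def cone_penalty_def cone_exp_def cone_radius_def h_def)
  then have start: "W1 z0 - W2 z0 - \<psi> z0 \<ge> \<delta>" using \<delta> by linarith
  have z0_box: "z0 \<in> ?box a" using a t0 P by (auto simp: z0_def)
  \<comment> \<open>A low penalty excludes the lateral boundary and the bottom of the box; the top
    is excluded later by the common terminal values.\<close>
  have interior: "fst z \<in> ball x0 P \<and> fst (snd z) \<in> ball u0 P \<and> a < snd (snd z)"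
    if z: "z \<in> ?box a" "\<psi> z < S + \<delta>" for z
  proof -
    have t: "0 < snd (snd z)" "a \<le> snd (snd z)" "snd (snd z) \<le> T" using z(1) a(1) by auto
    have "cone_radius x0 u0 z < P"
    proof (rule ccontr)
      assume "\<not> cone_radius x0 u0 z < P"
      moreover have "C * (snd (snd z) - t0) \<le> C * T" using C t t0 by (intro mult_left_mono) auto
      ultimately have "1 \<le> cone_radius x0 u0 z - C * (snd (snd z) - t0) - 2" by (simp add: P_def)
      from mult_left_mono[OF this N(1)] have "exp N \<le> cone_exp C N x0 u0 t0 z" by (simp add: cone_exp_def)
      moreover have "h / snd (snd z) > 0" using h t by simp
      ultimately show False using z(2) exp_N by (simp add: \<psi>_def cone_penalty_def)
    qed
    then have "norm (fst z - x0) < P" "norm (fst (snd z) - u0) < P"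
      using norm_le_cone_radius(1)[of z x0 u0] norm_le_cone_radius(2)[of z u0 x0] by linarith+
    moreover have "snd (snd z) \<noteq> a"
    proof
      assume "snd (snd z) = a"
      then have "\<psi> z > S + \<delta>" using a(3) by (simp add: \<psi>_def cone_penalty_def cone_exp_def)
      with z(2) show False by simp
    qed
    ultimately show ?thesis using t by (simp add: dist_norm norm_minus_commute)
  qed
  note cont_a = cont[OF less_imp_le[OF a(1)]]
  have \<psi>_cont: "continuous_on (?box a) \<psi>"
    unfolding \<psi>_def using a(1) by (intro continuous_on_cone_penalty) auto
  \<comment> \<open>The first entry excludes time T. The second puts the final error 4 * L * (2 *
    \<kappa>) + 2 * L * \<kappa> below h / T^2; the + 1 keeps the divisor positive when L =
    0.\<close>
  define \<kappa> where "\<kappa> = min (\<delta> / 2) (h / (T\<^sup>2 * (18 * L + 1)))"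
  have \<kappa>: "\<kappa> > 0" "\<kappa> \<le> \<delta> / 2" "18 * L * \<kappa> < h / T\<^sup>2"
  proof -
    have L1: "18 * L + 1 > 0" using L_nonneg by simp
    show "\<kappa> > 0" using \<delta> h T_pos L1 by (simp add: \<kappa>_def)
    show "\<kappa> \<le> \<delta> / 2" unfolding \<kappa>_def by (rule min.cobounded1)
    have "(18 * L + 1) * \<kappa> \<le> (18 * L + 1) * (h / (T\<^sup>2 * (18 * L + 1)))"
      using L1 by (intro mult_left_mono) (auto simp: \<kappa>_def)
    also have "\<dots> = h / T\<^sup>2" using L1 by simp
    finally show "18 * L * \<kappa> < h / T\<^sup>2" using \<open>\<kappa> > 0\<close> by (simp add: algebra_simps)
  qed
  have unif: "\<exists>d>0. \<forall>z\<in>?box a. \<forall>z'\<in>?box a. dist z' z < d \<longrightarrow> dist (F z') (F z) < \<kappa>"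
    if "continuous_on (?box a) F" for F :: "_ \<Rightarrow> real"
    using compact_uniformly_continuous[OF that compact] \<kappa>(1) unfolding uniformly_continuous_on_def by blast
  obtain d1 where d1: "d1 > 0" "\<And>z z'. z \<in> ?box a \<Longrightarrow> z' \<in> ?box a \<Longrightarrow> dist z' z < d1 \<Longrightarrow> dist (W1 z') (W1 z) < \<kappa>"
    using unif[OF cont_a(1)] by force
  obtain d2 where d2: "d2 > 0" "\<And>z z'. z \<in> ?box a \<Longrightarrow> z' \<in> ?box a \<Longrightarrow> dist z' z < d2 \<Longrightarrow> dist (W2 z') (W2 z) < \<kappa>"
    using unif[OF cont_a(2)] by force
  obtain d3 where d3: "d3 > 0" "\<And>z z'. z \<in> ?box a \<Longrightarrow> z' \<in> ?box a \<Longrightarrow> dist z' z < d3 \<Longrightarrow> dist (\<psi> z') (\<psi> z) < \<kappa>"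
    using unif[OF \<psi>_cont] by force
  define \<gamma> where "\<gamma> = Min {d1, d2, d3, \<kappa>}"
  have \<gamma>: "\<gamma> > 0" "\<gamma> \<le> d1" "\<gamma> \<le> d2" "\<gamma> \<le> d3" "\<gamma> \<le> \<kappa>" using d1 d2 d3 \<kappa> by (auto simp: \<gamma>_def)
  \<comment> \<open>At the maximum, k times the squared distance is at most S, half of k *
    \<gamma>^2; so the two points are closer than the common modulus \<gamma>.\<close>
  define k where "k = 2 * S / \<gamma>\<^sup>2"
  have k: "k > 0" "k * \<gamma>\<^sup>2 = 2 * S" using S(1) \<gamma>(1) by (auto simp: k_def)
  define \<Phi> where "\<Phi> = (\<lambda>(z, z'). W1 z - W2 z' - \<psi> z - k * ((z - z') \<bullet> (z - z')))"
  have "continuous_on (?box a \<times> ?box a) \<Phi>"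
    unfolding \<Phi>_def case_prod_beta
    by (intro continuous_intros continuous_on_compose2[OF cont_a(1)] continuous_on_compose2[OF cont_a(2)]
        continuous_on_compose2[OF \<psi>_cont]) auto
  moreover have "compact (?box a \<times> ?box a)" by (rule compact_Times[OF compact compact])
  moreover have "?box a \<times> ?box a \<noteq> {}" using z0_box by blast
  ultimately obtain m where m: "m \<in> ?box a \<times> ?box a" "\<And>w. w \<in> ?box a \<times> ?box a \<Longrightarrow> \<Phi> w \<le> \<Phi> m"
    using continuous_attains_sup by metis
  obtain z z' where zz: "m = (z, z')" by (cases m)
  have box: "z \<in> ?box a" "z' \<in> ?box a" using m(1) zz by auto
  then have box0: "z \<in> ?box 0" "z' \<in> ?box 0" using a(1) by auto
  have max: "W1 w - W2 w' - \<psi> w - k * ((w - w') \<bullet> (w - w')) \<le> W1 z - W2 z' - \<psi> z - k * ((z - z') \<bullet> (z - z'))"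
    if "w \<in> ?box a" "w' \<in> ?box a" for w w'
    using m(2)[of "(w, w')"] that by (auto simp: \<Phi>_def zz)
  have quad_nonneg: "k * ((z - z') \<bullet> (z - z')) \<ge> 0" using k by simp
  have big: "W1 z - W2 z' - \<psi> z - k * ((z - z') \<bullet> (z - z')) \<ge> \<delta>"
    using max[OF z0_box z0_box] start by simp
  have "k * (norm (z - z'))\<^sup>2 \<le> S"
    using big S(2)[OF box0] \<psi>_nonneg[OF box(1)] \<delta>(1) by (simp add: power2_norm_eq_inner)
  then have "k * (norm (z - z'))\<^sup>2 < k * \<gamma>\<^sup>2" using k S(1) by linarith
  then have "norm (z - z') < \<gamma>"
    using k(1) \<gamma>(1) by (simp add: power_less_imp_less_base)
  then have close: "\<bar>W1 z - W1 z'\<bar> < \<kappa>" "\<bar>W2 z - W2 z'\<bar> < \<kappa>" "\<bar>\<psi> z - \<psi> z'\<bar> < \<kappa>" "norm (z - z') < \<kappa>"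
    using d1(2)[OF box(2,1)] d2(2)[OF box(2,1)] d3(2)[OF box(2,1)] \<gamma> by (auto simp: dist_norm)
  \<comment> \<open>Against the diagonal pair (z', z') the values of W2 cancel, and only the changes
    of W1 and \<psi> between z and z' remain, each below \<kappa>.\<close>
  have quad: "k * (norm (z - z'))\<^sup>2 \<le> 2 * \<kappa>"
    using max[OF box(2,2)] close by (simp add: power2_norm_eq_inner abs_less_iff)
  have eq_T: "W1 w = W2 w" if "snd (snd w) = T" for w
    using W1 W2 that unfolding hjb_viscosity_solution_def by (cases w) auto
  \<comment> \<open>If either time were T, W1 and W2 would agree at that point, and W1 z - W2 z'
    would be below \<kappa>, hence below \<delta>.\<close>
  have t: "snd (snd z) \<noteq> T" "snd (snd z') \<noteq> T"
    using eq_T[of z] eq_T[of z'] big close \<kappa>(2) \<delta>(1) \<psi>_nonneg[OF box(1)] quad_nonneg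
    by (auto simp: abs_less_iff)
  have "\<psi> z \<le> S - \<delta>" using big S(2)[OF box0] quad_nonneg by linarith
  then have \<psi>_less: "\<psi> z < S + \<delta>" "\<psi> z' < S + \<delta>" using close \<kappa>(2) \<delta>(1) by (auto simp: abs_less_iff)
  let ?U = "ball x0 P \<times> ball u0 P \<times> {a<..<T}"
  have U: "open ?U" "?U \<subseteq> ?box a" by (auto intro!: open_Times simp: less_imp_le)
  have zU: "z \<in> ?U" "z' \<in> ?U"
    using interior[OF box(1) \<psi>_less(1)] interior[OF box(2) \<psi>_less(2)] t box by (auto simp: mem_Times_iff)
  have "local_max_at (\<lambda>w. W1 w - (k * ((w - z') \<bullet> (w - z')) + \<psi> w)) z"
    unfolding local_max_at_def eventually_nhds
  proof (intro exI[of _ ?U] conjI ballI)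
    fix w assume "w \<in> ?U"
    then have "w \<in> ?box a" using U(2) by blast
    from max[OF this box(2)]
    show "W1 w - (k * ((w - z') \<bullet> (w - z')) + \<psi> w) \<le> W1 z - (k * ((z - z') \<bullet> (z - z')) + \<psi> z)" by linarith
  qed (use U zU in auto)
  moreover have "local_min_at (\<lambda>w. W2 w - (- k) * ((w - z) \<bullet> (w - z))) z'"
    unfolding local_min_at_def eventually_nhds
  proof (intro exI[of _ ?U] conjI ballI)
    fix w assume "w \<in> ?U"
    then have "w \<in> ?box a" using U(2) by blast
    from max[OF box(1) this]
    show "W2 z' - (- k) * ((z' - z) \<bullet> (z' - z)) \<le> W2 w - (- k) * ((w - z) \<bullet> (w - z))"
      by (simp add: inner_diff_left inner_diff_right inner_commute algebra_simps)
  qed (use U zU in auto)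
  moreover have "snd (snd z) \<in> {0<..<T}" "snd (snd z') \<in> {0<..<T}" using zU a(1) by auto
  ultimately have "h / T\<^sup>2 \<le> 4 * L * k * (norm (z - z'))\<^sup>2 + 2 * L * norm (z - z')"
    using k(1) N(1) h unfolding \<psi>_def C_def by (intro doubling_contradiction[OF W1 W2]) auto
  also have "\<dots> = 4 * L * (k * (norm (z - z'))\<^sup>2) + 2 * L * norm (z - z')" by simp
  also have "\<dots> \<le> 4 * L * (2 * \<kappa>) + 2 * L * \<kappa>"
    using quad close L_nonneg by (intro add_mono mult_left_mono) auto
  also have "\<dots> \<le> 18 * L * \<kappa>" using L_nonneg \<kappa>(1) by (simp add: algebra_simps)
  finally show False using \<kappa>(3) by simp
qed

text \<open>Comparison in both directions gives equality at interior times; continuity carries it to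
  the end times, in particular to t = 0, where neither the equation nor the terminal condition
  speaks.\<close>

lemma viscosity_solution_unique:
  assumes W1: "hjb_viscosity_solution T M f r q W1" and W2: "hjb_viscosity_solution T M f r q W2"
    and z: "z \<in> UNIV \<times> UNIV \<times> {0..T}"
  shows "W1 z = W2 z"
proof -
  obtain x u t where zz: "z = (x, u, t)" "t \<in> {0..T}" using z by auto
  have "W1 (x, u, s) = W2 (x, u, s)" if "s \<in> {0<..<T}" for s
    using comparison_interior[OF W1 W2 that] comparison_interior[OF W2 W1 that] by (rule antisym)
  note interior = this
  have cont: "continuous_on {0..T} (\<lambda>s. W (x, u, s))"
    if "continuous_on (UNIV \<times> UNIV \<times> {0..T}) W" for W :: "_ \<Rightarrow> real"
    by (rule continuous_on_compose2[OF that]) (auto intro!: continuous_intros)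
  have "continuous_on (closure {0<..<T}) (\<lambda>s. W1 (x, u, s) - W2 (x, u, s))"
    using W1 W2 T_pos unfolding hjb_viscosity_solution_def
    by (auto intro!: continuous_on_diff cont)
  then have "W1 (x, u, t) - W2 (x, u, t) = 0"
    by (rule continuous_constant_on_closure) (use interior zz(2) T_pos in auto)
  then show ?thesis using zz by simp
qed

end

theorem theorem3:
  fixes T M :: real
    and f :: "(real ^ 'n) \<times> (real ^ 'm) \<Rightarrow> (real ^ 'n)"
    and r :: "(real ^ 'n) \<times> (real ^ 'm) \<Rightarrow> real"
    and q :: "(real ^ 'n) \<Rightarrow> real"
  assumes "T > 0" and "M > 0"
    and "bounded (range f)" and "\<exists>L. L-lipschitz_on UNIV f"
    and "bounded (range r)" and "\<exists>L. L-lipschitz_on UNIV r"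
    and "bounded (range q)" and "\<exists>L. L-lipschitz_on UNIV q"
  shows "hjb_viscosity_solution T M f r q (value_function T M f r q) \<and>
    (\<forall>W. hjb_viscosity_solution T M f r q W \<longrightarrow>
       (\<forall>z\<in>UNIV \<times> UNIV \<times> {0..T}. W z = value_function T M f r q z)) \<and>
    bounded (value_function T M f r q ` (UNIV \<times> UNIV \<times> {0..T})) \<and>
    (\<exists>L. L-lipschitz_on (UNIV \<times> UNIV \<times> {0..T}) (value_function T M f r q))"
proof -
  obtain Bf Br Bq where B: "\<And>z. norm (f z) \<le> Bf" "\<And>z. \<bar>r z\<bar> \<le> Br" "\<And>x. \<bar>q x\<bar> \<le> Bq"
    using assms(3,5,7) unfolding bounded_iff by auto
  obtain Lf Lr Lq where L: "Lf-lipschitz_on UNIV f" "Lr-lipschitz_on UNIV r" "Lq-lipschitz_on UNIV q"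
    using assms(4,6,8) by blast
  define B where "B = max Bf (max Br Bq)"
  define L where "L = max Lf (max Lr Lq)"
  interpret bounded_lipschitz_control T M L B f r q
  proof
    show "norm (f z) \<le> B" "\<bar>r z\<bar> \<le> B" "\<bar>q x\<bar> \<le> B" for z x
      using B(1)[of z] B(2)[of z] B(3)[of x] by (simp_all add: B_def le_max_iff_disj)
    show "L-lipschitz_on UNIV f" "L-lipschitz_on UNIV r" "L-lipschitz_on UNIV q"
      by (rule lipschitz_on_mono[OF L(1)], simp, simp add: L_def)
         (rule lipschitz_on_mono[OF L(2)], simp, simp add: L_def,
          rule lipschitz_on_mono[OF L(3)], simp, simp add: L_def)
  qed (use assms in auto)
  have "bounded (V ` (UNIV \<times> UNIV \<times> {0..T}))"
    unfolding bounded_iff using abs_V_le by fastforce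
  then show ?thesis
    using V_viscosity_solution viscosity_solution_unique V_lipschitz by blast
qed

end
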